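(* Let $p:X\to\vec S^1$ be a regular clock map, with $X$ saturated. Then, for every pair of states $\alpha,\beta\in|X|$, the canonical quotient map $$q_{\alpha,\beta}:\vec P(X)(\alpha,\beta)\longrightarrow\vec T(X)(\alpha,\beta)$$ is a homotopy equivalence. In particular, it is a weak homotopy equivalence.
   Context: $\mathbf{Top}$ denotes either the category of $\Delta$-generated topological spaces (spaces whose topology is final with respect to all continuous maps from $[0,1]$, equivalently from topological simplices) or its full subcategory of $\Delta$-Hausdorff $\Delta$-generated spaces (those in which the image of every continuous map from $[0,1]$ is closed); the result is for either choice. The $\Delta$-kelleyfication is the right adjoint of the inclusion of $\Delta$-generated spaces into all topological spaces (same set, topology refined to the $\Delta$-generated one). Products and subspaces are taken in $\mathbf{Top}$ (i.e. $\Delta$-kelleyfied). $\mathcal I$ is the set of nondecreasing continuous maps $[0,1]\to[0,1]$ and $\mathcal I_0=\{\phi\in\mathcal I\mid\phi(0)=0,\phi(1)=1\}$. A directed space is a pair $X=(|X|,\vec P(X))$ with $|X|$ in $\mathbf{Top}$ (its points are called states) and $\vec P(X)$ a set of continuous maps $[0,1]\to|X|$ (directed paths) containing all constant paths, closed under normalized composition ($(\gamma_1*_N\gamma_2)(t)=\gamma_1(2t)$ for $t\le 1/2$ and $\gamma_2(2t-1)$ for $t\ge 1/2$, when $\gamma_1(1)=\gamma_2(0)$) and under precomposition by elements of $\mathcal I$. A morphism $X\to Y$ is a continuous map $|X|\to|Y|$ sending directed paths to directed paths by postcomposition. $X$ is saturated if whenever $v:[0,1]\to|X|$ is continuous, $\phi\in\mathcal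 I_0$ and $v\circ\phi\in\vec P(X)$, then $v\in\vec P(X)$. $\vec P(X)$ carries the $\Delta$-kelleyfication of the compact-open topology, and $\vec P(X)(\alpha,\beta)$ is the subspace of directed paths $u$ with $u(0)=\alpha$, $u(1)=\beta$. The directed circle $\vec S^1$ is $\mathbb R/\mathbb Z$ with directed paths the continuous $c:[0,1]\to\mathbb R/\mathbb Z$ admitting a nondecreasing continuous lift $[0,1]\to\mathbb R$. A regular clock map is a morphism of directed spaces $p:X\to\vec S^1$ with $X$ saturated such that for every $u\in\vec P(X)$, $p\circ u$ constant implies $u$ constant. The trace space $\vec T(X)(\alpha,\beta)$ is the quotient, taken in $\mathbf{Top}$, of $\vec P(X)(\alpha,\beta)$ by the equivalence relation generated by $u\sim u\circ\phi$ for $\phi\in\mathcal I_0$, and $q_{\alpha,\beta}$ is the quotient map. *)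

theory Defs
  imports "HOL-Analysis.Analysis"
begin

section \<open>Delta-generated spaces\<close>

abbreviation unit_interval :: "real set" where
  "unit_interval \<equiv> {0..1}"

abbreviation delta_open :: "'a topology \<Rightarrow> 'a set \<Rightarrow> bool" where
  "delta_open X U \<equiv> U \<subseteq> topspace X \<and>
     (\<forall>g. pathin X g \<longrightarrow> openin (top_of_set unit_interval) {t \<in> unit_interval. g t \<in> U})"

definition delta_generated :: "'a topology \<Rightarrow> bool" where
  "delta_generated X \<longleftrightarrow> (\<forall>U. openin X U \<longleftrightarrow> delta_open X U)"

definition delta_kelleyfication :: "'a topology \<Rightarrow> 'a topology" where
  "delta_kelleyfication X = topology (delta_open X)"

lemma openin_delta_kelleyfication:
  "openin (delta_kelleyfication X) U \<longleftrightarrow> delta_open X U"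
proof -
  have "istopology (delta_open X)"
    unfolding istopology_def
  proof (intro conjI allI impI)
    fix S T g assume S: "delta_open X S" and T: "delta_open X T"
    then show "S \<inter> T \<subseteq> topspace X" by blast
    assume g: "pathin X g"
    have "{t \<in> unit_interval. g t \<in> S \<inter> T}
        = {t \<in> unit_interval. g t \<in> S} \<inter> {t \<in> unit_interval. g t \<in> T}"
      by blast
    with S T g show "openin (top_of_set unit_interval) {t \<in> unit_interval. g t \<in> S \<inter> T}"
      by (simp add: openin_Int)
  next
    fix K g assume K: "\<forall>S\<in>K. delta_open X S"
    then show "\<Union>K \<subseteq> topspace X" by blast
    assume g: "pathin X g"
    have "{t \<in> unit_interval. g t \<in> \<Union>K} = (\<Union>S\<in>K. {t \<in> unit_interval. g t \<in> S})"
      by blast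
    moreover have "openin (top_of_set unit_interval) (\<Union>S\<in>K. {t \<in> unit_interval. g t \<in> S})"
      using K g by (intro openin_Union) auto
    ultimately show "openin (top_of_set unit_interval) {t \<in> unit_interval. g t \<in> \<Union>K}"
      by simp
  qed
  then show ?thesis
    by (simp add: delta_kelleyfication_def topology_inverse')
qed

lemma topspace_delta_kelleyfication [simp]:
  "topspace (delta_kelleyfication X) = topspace X"
proof -
  have "delta_open X (topspace X)"
  proof (intro conjI allI impI)
    fix g assume "pathin X g"
    then have "{t \<in> unit_interval. g t \<in> topspace X} = unit_interval"
      by (auto simp: pathin_def continuous_map_def)
    then show "openin (top_of_set unit_interval) {t \<in> unit_interval. g t \<in> topspace X}"
      by simp
  qed simp
  then show ?thesis
    unfolding topspace_def[of "delta_kelleyfication X"] openin_delta_kelleyfication by auto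
qed

definition delta_Hausdorff :: "'a topology \<Rightarrow> bool" where
  "delta_Hausdorff X \<longleftrightarrow> (\<forall>g. pathin X g \<longrightarrow> closedin X (g ` unit_interval))"

text \<open>The two admissible choices of the category \<open>Top\<close>.\<close>

datatype top_choice = Delta_Generated | Delta_Generated_Hausdorff

fun in_Top :: "top_choice \<Rightarrow> 'a topology \<Rightarrow> bool" where
  "in_Top Delta_Generated X \<longleftrightarrow> delta_generated X"
| "in_Top Delta_Generated_Hausdorff X \<longleftrightarrow> delta_generated X \<and> delta_Hausdorff X"


section \<open>Quotient spaces\<close>

definition quotient_topology :: "'a topology \<Rightarrow> ('a \<times> 'a) set \<Rightarrow> 'a set topology" where
  "quotient_topology X R =
     topology (\<lambda>U. U \<subseteq> topspace X // R \<and> openin X {x \<in> topspace X. R `` {x} \<in> U})"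

lemma openin_quotient_topology:
  "openin (quotient_topology X R) U \<longleftrightarrow>
     U \<subseteq> topspace X // R \<and> openin X {x \<in> topspace X. R `` {x} \<in> U}"
proof -
  have "istopology (\<lambda>U. U \<subseteq> topspace X // R \<and> openin X {x \<in> topspace X. R `` {x} \<in> U})"
    unfolding istopology_def
  proof (intro conjI allI impI)
    fix S T
    assume S: "S \<subseteq> topspace X // R \<and> openin X {x \<in> topspace X. R `` {x} \<in> S}"
      and T: "T \<subseteq> topspace X // R \<and> openin X {x \<in> topspace X. R `` {x} \<in> T}"
    then show "S \<inter> T \<subseteq> topspace X // R" by blast
    have "{x \<in> topspace X. R `` {x} \<in> S \<inter> T}
        = {x \<in> topspace X. R `` {x} \<in> S} \<inter> {x \<in> topspace X. R `` {x} \<in> T}"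
      by blast
    with S T show "openin X {x \<in> topspace X. R `` {x} \<in> S \<inter> T}"
      by (simp add: openin_Int)
  next
    fix K
    assume K: "\<forall>S\<in>K. S \<subseteq> topspace X // R \<and> openin X {x \<in> topspace X. R `` {x} \<in> S}"
    then show "\<Union>K \<subseteq> topspace X // R" by blast
    have "{x \<in> topspace X. R `` {x} \<in> \<Union>K} = (\<Union>S\<in>K. {x \<in> topspace X. R `` {x} \<in> S})"
      by blast
    moreover have "openin X (\<Union>S\<in>K. {x \<in> topspace X. R `` {x} \<in> S})"
      using K by (intro openin_Union) auto
    ultimately show "openin X {x \<in> topspace X. R `` {x} \<in> \<Union>K}"
      by simp
  qed
  then show ?thesis
    by (simp add: quotient_topology_def topology_inverse')
qed

text \<open>
  A quotient of a delta-generated space is delta-generated, but a quotient of a delta-Hausdorff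
  space need not be delta-Hausdorff.  In the second choice of \<open>Top\<close> the quotient by \<open>R\<close> is the
  delta-Hausdorff reflection of the topological quotient, which is the quotient by the least
  equivalence relation that contains \<open>R\<close> and has a delta-Hausdorff quotient.
\<close>

fun Top_quotient_rel ::
  "top_choice \<Rightarrow> 'a topology \<Rightarrow> ('a \<times> 'a) set \<Rightarrow> ('a \<times> 'a) set" where
  "Top_quotient_rel Delta_Generated X R = R"
| "Top_quotient_rel Delta_Generated_Hausdorff X R =
     \<Inter>{S. equiv (topspace X) S \<and> R \<subseteq> S \<and> delta_Hausdorff (quotient_topology X S)}"


section \<open>Directed spaces\<close>

text \<open>
  A map with domain \<open>[0,1]\<close> is represented by the function on the reals that agrees with it on
  \<open>[0,1]\<close> and is \<open>undefined\<close> elsewhere, so that equal maps are equal functions.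
\<close>

definition path_maps :: "'a topology \<Rightarrow> (real \<Rightarrow> 'a) set" where
  "path_maps X = {g \<in> extensional unit_interval. pathin X g}"

definition reparams :: "(real \<Rightarrow> real) set" where
  "reparams = {\<phi>. continuous_on unit_interval \<phi> \<and> \<phi> ` unit_interval \<subseteq> unit_interval \<and>
                  mono_on unit_interval \<phi>}"

definition reparams0 :: "(real \<Rightarrow> real) set" where
  "reparams0 = {\<phi> \<in> reparams. \<phi> 0 = 0 \<and> \<phi> 1 = 1}"

definition normalized_comp :: "(real \<Rightarrow> 'a) \<Rightarrow> (real \<Rightarrow> 'a) \<Rightarrow> real \<Rightarrow> 'a" where
  "normalized_comp g h =
     (\<lambda>t\<in>unit_interval. if t \<le> 1/2 then g (2 * t) else h (2 * t - 1))"

record 'a dspace =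
  dtop :: "'a topology"
  dpaths :: "(real \<Rightarrow> 'a) set"

abbreviation states :: "'a dspace \<Rightarrow> 'a set" where
  "states X \<equiv> topspace (dtop X)"

definition directed_space :: "top_choice \<Rightarrow> 'a dspace \<Rightarrow> bool" where
  "directed_space C X \<longleftrightarrow>
     in_Top C (dtop X) \<and>
     dpaths X \<subseteq> path_maps (dtop X) \<and>
     (\<forall>x\<in>states X. (\<lambda>t\<in>unit_interval. x) \<in> dpaths X) \<and>
     (\<forall>g\<in>dpaths X. \<forall>h\<in>dpaths X. g 1 = h 0 \<longrightarrow> normalized_comp g h \<in> dpaths X) \<and>
     (\<forall>g\<in>dpaths X. \<forall>\<phi>\<in>reparams. compose unit_interval g \<phi> \<in> dpaths X)"

definition dmorphism :: "'a dspace \<Rightarrow> 'b dspace \<Rightarrow> ('a \<Rightarrow> 'b) \<Rightarrow> bool" where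
  "dmorphism X Y f \<longleftrightarrow>
     continuous_map (dtop X) (dtop Y) f \<and>
     (\<forall>u\<in>dpaths X. compose unit_interval f u \<in> dpaths Y)"

definition saturated :: "'a dspace \<Rightarrow> bool" where
  "saturated X \<longleftrightarrow>
     (\<forall>v\<in>path_maps (dtop X). \<forall>\<phi>\<in>reparams0.
        compose unit_interval v \<phi> \<in> dpaths X \<longrightarrow> v \<in> dpaths X)"

definition int_congruence :: "(real \<times> real) set" where
  "int_congruence = {(x, y). x - y \<in> \<int>}"

definition dcircle :: "real set dspace" where
  "dcircle =
     (let S = quotient_topology euclideanreal int_congruence in
      \<lparr>dtop = S,
       dpaths = {c \<in> path_maps S.
         \<exists>l. continuous_on unit_interval l \<and> mono_on unit_interval l \<and>
             (\<forall>t\<in>unit_interval. c t = int_congruence `` {l t})}\<rparr>)"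

definition regular_clock_map :: "top_choice \<Rightarrow> 'a dspace \<Rightarrow> ('a \<Rightarrow> real set) \<Rightarrow> bool" where
  "regular_clock_map C X p \<longleftrightarrow>
     directed_space C X \<and> saturated X \<and> dmorphism X dcircle p \<and>
     (\<forall>u\<in>dpaths X. (p \<circ> u) constant_on unit_interval \<longrightarrow> u constant_on unit_interval)"


section \<open>Path spaces and trace spaces\<close>

text \<open>The subbasic set given by \<open>K = {}\<close> is the set of all maps, so the carrier is \<open>path_maps X\<close>.\<close>

definition compact_open_paths :: "'a topology \<Rightarrow> (real \<Rightarrow> 'a) topology" where
  "compact_open_paths X =
     topology_generated_by
       {{g \<in> path_maps X. g ` K \<subseteq> U} |K U. compactin (top_of_set unit_interval) K \<and> openin X U}"

definition dpath_space :: "'a dspace \<Rightarrow> (real \<Rightarrow> 'a) topology" where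
  "dpath_space X =
     delta_kelleyfication (subtopology (compact_open_paths (dtop X)) (dpaths X))"

definition dpath_space_between :: "'a dspace \<Rightarrow> 'a \<Rightarrow> 'a \<Rightarrow> (real \<Rightarrow> 'a) topology" where
  "dpath_space_between X \<alpha> \<beta> =
     delta_kelleyfication (subtopology (dpath_space X) {u. u 0 = \<alpha> \<and> u 1 = \<beta>})"

definition trace_rel :: "'a dspace \<Rightarrow> 'a \<Rightarrow> 'a \<Rightarrow> ((real \<Rightarrow> 'a) \<times> (real \<Rightarrow> 'a)) set" where
  "trace_rel X \<alpha> \<beta> =
     (let P = topspace (dpath_space_between X \<alpha> \<beta>) in
      {(u, v). u \<in> P \<and> v \<in> P \<and>
         equivclp (\<lambda>a b. a \<in> P \<and> (\<exists>\<phi>\<in>reparams0. b = compose unit_interval a \<phi>)) u v})"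

definition Top_trace_rel ::
  "top_choice \<Rightarrow> 'a dspace \<Rightarrow> 'a \<Rightarrow> 'a \<Rightarrow> ((real \<Rightarrow> 'a) \<times> (real \<Rightarrow> 'a)) set" where
  "Top_trace_rel C X \<alpha> \<beta> =
     Top_quotient_rel C (dpath_space_between X \<alpha> \<beta>) (trace_rel X \<alpha> \<beta>)"

definition trace_space ::
  "top_choice \<Rightarrow> 'a dspace \<Rightarrow> 'a \<Rightarrow> 'a \<Rightarrow> (real \<Rightarrow> 'a) set topology" where
  "trace_space C X \<alpha> \<beta> =
     quotient_topology (dpath_space_between X \<alpha> \<beta>) (Top_trace_rel C X \<alpha> \<beta>)"

definition trace_map ::
  "top_choice \<Rightarrow> 'a dspace \<Rightarrow> 'a \<Rightarrow> 'a \<Rightarrow> (real \<Rightarrow> 'a) \<Rightarrow> (real \<Rightarrow> 'a) set" where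
  "trace_map C X \<alpha> \<beta> u = Top_trace_rel C X \<alpha> \<beta> `` {u}"


section \<open>Homotopy equivalences and weak homotopy equivalences\<close>

text \<open>
  The library's \<open>homotopic_with\<close> uses the ordinary product with \<open>[0,1]\<close>.  The ordinary product of
  \<open>[0,1]\<close> with a delta-generated space is already delta-generated, hence equal to the product
  in \<open>Top\<close>.
\<close>

definition homotopy_equivalence_map :: "'a topology \<Rightarrow> 'b topology \<Rightarrow> ('a \<Rightarrow> 'b) \<Rightarrow> bool" where
  "homotopy_equivalence_map X Y f \<longleftrightarrow>
     continuous_map X Y f \<and>
     (\<exists>g. continuous_map Y X g \<and>
          homotopic_with (\<lambda>h. True) X X (g \<circ> f) id \<and>
          homotopic_with (\<lambda>h. True) Y Y (f \<circ> g) id)"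

definition cube :: "nat \<Rightarrow> (nat \<Rightarrow> real) topology" where
  "cube n = product_topology (\<lambda>i. top_of_set unit_interval) {..<n}"

definition cube_boundary :: "nat \<Rightarrow> (nat \<Rightarrow> real) set" where
  "cube_boundary n = {z \<in> topspace (cube n). \<exists>i<n. z i = 0 \<or> z i = 1}"

definition spheroids :: "nat \<Rightarrow> 'a topology \<Rightarrow> 'a \<Rightarrow> ((nat \<Rightarrow> real) \<Rightarrow> 'a) set" where
  "spheroids n X x =
     {f \<in> extensional (topspace (cube n)).
        continuous_map (cube n) X f \<and> (\<forall>z\<in>cube_boundary n. f z = x)}"

definition spheroid_homotopy ::
  "nat \<Rightarrow> 'a topology \<Rightarrow> 'a \<Rightarrow> (((nat \<Rightarrow> real) \<Rightarrow> 'a) \<times> ((nat \<Rightarrow> real) \<Rightarrow> 'a)) set" where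
  "spheroid_homotopy n X x =
     {(f, g). f \<in> spheroids n X x \<and> g \<in> spheroids n X x \<and>
        homotopic_with (\<lambda>h. \<forall>z\<in>cube_boundary n. h z = x) (cube n) X f g}"

definition homotopy_group :: "nat \<Rightarrow> 'a topology \<Rightarrow> 'a \<Rightarrow> ((nat \<Rightarrow> real) \<Rightarrow> 'a) set set" where
  "homotopy_group n X x = spheroids n X x // spheroid_homotopy n X x"

definition homotopy_group_map ::
  "nat \<Rightarrow> 'b topology \<Rightarrow> ('a \<Rightarrow> 'b) \<Rightarrow> 'a
     \<Rightarrow> ((nat \<Rightarrow> real) \<Rightarrow> 'a) set \<Rightarrow> ((nat \<Rightarrow> real) \<Rightarrow> 'b) set" where
  "homotopy_group_map n Y f x c =
     spheroid_homotopy n Y (f x) `` ((\<lambda>s. compose (topspace (cube n)) f s) ` c)"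

text \<open>
  The maps induced on homotopy groups are group homomorphisms, so that bijectivity is the same as
  being an isomorphism and the group structure need not be mentioned.
\<close>

definition weak_homotopy_equivalence_map ::
  "'a topology \<Rightarrow> 'b topology \<Rightarrow> ('a \<Rightarrow> 'b) \<Rightarrow> bool" where
  "weak_homotopy_equivalence_map X Y f \<longleftrightarrow>
     continuous_map X Y f \<and>
     bij_betw (\<lambda>A. \<Union>x\<in>A. path_component_of_set Y (f x))
       (path_components_of X) (path_components_of Y) \<and>
     (\<forall>x\<in>topspace X. \<forall>n\<ge>1.
        bij_betw (homotopy_group_map n Y f x) (homotopy_group n X x) (homotopy_group n Y (f x)))"

end

(*
  A directed path u lifts, through the clock map, to a nondecreasing real function. Where this lift
  is constant u is constant by regularity, so u factors as (natural u) o (norm_clock u), where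
  norm_clock u is the lift rescaled to [0,1] and natural u runs at constant clock speed; saturation
  makes natural u a directed path. The clock of a reparametrized path is the reparametrized clock,
  hence two paths are trace equivalent iff they have the same natural representative, and the trace
  space is the image of the continuous idempotent u |-> natural u. A convex combination of
  norm_clock u with any fixed reparametrization phi deforms u into (natural u) o phi. With phi the
  identity this is the homotopy equivalence; with phi = norm_clock x it keeps x fixed, which gives
  the isomorphisms of homotopy groups at x without any change of base point.
*)
theory Submission
  imports Defs
begin

section \<open>Delta-generated topologies\<close>

text \<open>Lifts are chosen separately for each path, so the real work is continuity in the path.
  The path space is delta-generated, so it suffices to treat families along a path in it, that is,
  squares with coordinates time and parameter. A square is contractible, so one logarithm lifts all
  clocks of a family at once. The fixed end points force the total clock time to be the same
  throughout the family, so \<open>norm_clock\<close> divides by a constant, and its degenerate case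
  holds for all members or for none. A second obstacle is the quotient itself: in the
  delta-Hausdorff category it might identify more than trace equivalence does. It does not, because
  the trace map has a continuous section into the path space, which inherits the delta-Hausdorff
  property from \<open>X\<close>, and closed images of paths pull back along this section.\<close>

lemma delta_generatedD: "\<lbrakk>delta_generated A; delta_open A U\<rbrakk> \<Longrightarrow> openin A U"
  unfolding delta_generated_def by (drule spec[where x = U], erule iffD2)

text \<open>If \<open>U\<close> fails to be open at \<open>a\<close>, points outside
  \<open>U\<close> converge to \<open>a\<close>. Convexity lets a path run through all of them and
  end at \<open>a\<close>, by Dugundji extension from a convergent sequence of times; the preimage
  of \<open>U\<close> under that path is then not open at time 0.\<close>

lemma convex_imp_delta_generated:
  fixes S :: "'a::euclidean_space set"
  assumes "convex S"
  shows "delta_generated (top_of_set S)"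
  unfolding delta_generated_def
proof (intro allI iffI conjI impI)
  fix U g assume U: "openin (top_of_set S) U"
  show "U \<subseteq> topspace (top_of_set S)" using openin_subset[OF U] .
  assume "pathin (top_of_set S) g"
  from openin_continuous_map_preimage[OF this[unfolded pathin_def] U]
  show "openin (top_of_set unit_interval) {t \<in> unit_interval. g t \<in> U}" by simp
next
  fix U assume "delta_open (top_of_set S) U"
  then have US: "U \<subseteq> S" and
    U: "\<And>g. pathin (top_of_set S) g \<Longrightarrow> openin (top_of_set unit_interval) {t \<in> unit_interval. g t \<in> U}"
    by auto
  show "openin (top_of_set S) U"
  proof (rule ccontr)
    assume "\<not> openin (top_of_set S) U"
    then obtain a where aU: "a \<in> U" and a: "\<And>e. e > 0 \<Longrightarrow> \<not> ball a e \<inter> S \<subseteq> U"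
      unfolding openin_contains_ball using US by blast
    have "\<forall>n. \<exists>x. x \<in> S - U \<and> dist a x < inverse (real (Suc n))"
    proof
      fix n show "\<exists>x. x \<in> S - U \<and> dist a x < inverse (real (Suc n))"
        using a[of "inverse (real (Suc n))"] by (auto simp: subset_iff simp del: of_nat_Suc)
    qed
    then obtain x where x: "\<And>n. x n \<in> S - U" "\<And>n. dist a (x n) < inverse (real (Suc n))"
      by metis
    define A where "A = insert 0 (range (\<lambda>n. inverse (real (Suc n))))"
    \<comment> \<open>The index \<open>nat \<lfloor>inverse t\<rfloor> - 1\<close> recovers
      \<open>n\<close> from the time \<open>t = 1 / (n + 1)\<close>.\<close>
    define f where "f t = (if t = 0 then a else x (nat \<lfloor>inverse t\<rfloor> - 1))" for t :: real
    have f_inv: "f (inverse (real (Suc n))) = x n" for n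
      by (simp add: f_def nat_add_distrib)
    have lim: "(\<lambda>n. inverse (real (Suc n))) \<longlonglongrightarrow> 0"
      by (rule LIMSEQ_inverse_real_of_nat)
    have "compact A"
      unfolding A_def using compact_sequence_with_limit[OF lim] by simp
    moreover have AI: "A \<subseteq> unit_interval"
      unfolding A_def by (auto simp: field_simps)
    ultimately have clA: "closedin (top_of_set unit_interval) A"
      by (simp add: closed_subset compact_imp_closed)
    have dist_f: "dist (f t) a \<le> t" if "t \<in> A" for t
      using that x(2) less_imp_le[OF x(2)] dist_commute[of a] unfolding A_def
      by (auto simp: f_inv simp del: of_nat_Suc) (simp add: f_def)
    have contf: "continuous_on A f"
      unfolding continuous_on_eq_continuous_within
    proof
      fix t assume t: "t \<in> A"
      show "continuous (at t within A) f"
      proof (cases "t = 0")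
        case True
        have "((\<lambda>s. dist (f s) a) \<longlongrightarrow> 0) (at 0 within A)"
        proof (rule tendsto_sandwich[of "\<lambda>_. 0" _ _ "\<lambda>s. s"])
          show "\<forall>\<^sub>F s in at 0 within A. dist (f s) a \<le> s"
            by (simp add: eventually_at_filter dist_f)
        qed (auto intro: tendsto_eq_intros)
        moreover have "f 0 = a"
          by (simp add: f_def)
        ultimately show ?thesis
          unfolding True continuous_within by (subst tendsto_dist_iff) simp
      next
        case False
        then obtain n where n: "t = inverse (real (Suc n))"
          using t A_def by auto
        \<comment> \<open>Only finitely many points of \<open>A\<close> lie above the term following
          \<open>t\<close>, so \<open>t\<close> is isolated in \<open>A\<close>.\<close>
        have "m \<le> n" if "inverse (real (Suc (Suc n))) < inverse (real (Suc m))" for m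
          using that by (subst (asm) inverse_less_iff_less) auto
        then have "A \<inter> {inverse (real (Suc (Suc n)))<..} \<subseteq> (\<lambda>n. inverse (real (Suc n))) ` {..n}"
          unfolding A_def by (auto simp del: of_nat_Suc inverse_less_iff_less)
        then have "finite (A \<inter> {inverse (real (Suc (Suc n)))<..})"
          using finite_subset by blast
        moreover have "t \<in> {inverse (real (Suc (Suc n)))<..}"
          by (simp add: n field_simps)
        ultimately have "\<not> t islimpt A"
          using islimpt_Int_eventually[OF _ eventually_at_in_open'[OF open_greaterThan]] islimpt_finite
          by blast
        then show ?thesis
          by (simp add: continuous_within flip: trivial_limit_within)
      qed
    qed
    obtain g where g: "continuous_on unit_interval g" "g ` unit_interval \<subseteq> S"
      "\<And>t. t \<in> A \<Longrightarrow> g t = f t"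
    proof (rule Dugundji[OF assms _ clA contf])
      show "f ` A \<subseteq> S"
        using x(1) aU US by (auto simp: A_def f_inv simp del: of_nat_Suc) (auto simp: f_def)
    qed (use aU US in auto)
    have "openin (top_of_set unit_interval) {t \<in> unit_interval. g t \<in> U}"
      using g by (intro U) (auto simp: pathin_def)
    moreover have "0 \<in> {t \<in> unit_interval. g t \<in> U}"
      using g(3)[of 0] aU by (simp add: A_def f_def)
    ultimately obtain e where e: "e > 0" "ball 0 e \<inter> unit_interval \<subseteq> {t \<in> unit_interval. g t \<in> U}"
      unfolding openin_contains_ball by blast
    obtain n where n: "inverse (real (Suc n)) < e"
      using reals_Archimedean[OF e(1)] by auto
    have inA: "inverse (real (Suc n)) \<in> A"
      by (auto simp: A_def)
    then have "inverse (real (Suc n)) \<in> ball 0 e \<inter> unit_interval"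
      using n AI by auto
    then have "g (inverse (real (Suc n))) \<in> U"
      using e(2) by blast
    then show False
      using g(3)[OF inA] x(1) f_inv by simp
  qed
qed

text \<open>The universal property of the coreflection: openness in \<open>A\<close> is tested on
  paths, and \<open>f\<close> carries paths of \<open>A\<close> to paths of
  \<open>Z\<close>.\<close>

lemma continuous_map_into_delta_kelleyfication:
  assumes "delta_generated A"
  shows "continuous_map A (delta_kelleyfication Z) f \<longleftrightarrow> continuous_map A Z f"
proof
  assume f: "continuous_map A (delta_kelleyfication Z) f"
  have "openin (delta_kelleyfication Z) U" if "openin Z U" for U
    unfolding openin_delta_kelleyfication pathin_def
    using that openin_subset openin_continuous_map_preimage by fastforce
  then show "continuous_map A Z f"
    using f by (simp add: continuous_map_def)
next
  assume f: "continuous_map A Z f"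
  have "openin A {x \<in> topspace A. f x \<in> U}" if "openin (delta_kelleyfication Z) U" for U
  proof -
    have "delta_open A {x \<in> topspace A. f x \<in> U}"
    proof (intro conjI allI impI)
      fix g assume g: "pathin A g"
      then have "pathin Z (f \<circ> g)"
        using f pathin_compose by blast
      then have "openin (top_of_set unit_interval) {t \<in> unit_interval. (f \<circ> g) t \<in> U}"
        using that by (simp only: openin_delta_kelleyfication)
      moreover have "g t \<in> topspace A" if "t \<in> unit_interval" for t
        using g that by (auto simp: pathin_def continuous_map_def)
      ultimately show "openin (top_of_set unit_interval) {t \<in> unit_interval. g t \<in> {x \<in> topspace A. f x \<in> U}}"
        by (simp cong: conj_cong)
    qed auto
    then show ?thesis
      using assms by (simp add: delta_generated_def)
  qed
  then show "continuous_map A (delta_kelleyfication Z) f"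
    using f by (simp add: continuous_map_def)
qed

lemma pathin_delta_kelleyfication [simp]: "pathin (delta_kelleyfication Z) g \<longleftrightarrow> pathin Z g"
  unfolding pathin_def
  by (rule continuous_map_into_delta_kelleyfication) (simp add: convex_imp_delta_generated)

lemma delta_generated_delta_kelleyfication: "delta_generated (delta_kelleyfication Z)"
  by (simp add: delta_generated_def openin_delta_kelleyfication)

section \<open>Joint continuity over the unit interval\<close>

text \<open>A tube lemma: the points violating the condition are the projection of a closed subset
  of \<open>K\<close> times \<open>A\<close>, and this projection is a closed map since
  \<open>K\<close> is compact.\<close>

lemma openin_tube:
  assumes f: "continuous_map (prod_topology (top_of_set unit_interval) A) Q f"
    and K: "compact K" "K \<subseteq> unit_interval" and W: "openin Q W"
  shows "openin A {a \<in> topspace A. \<forall>t\<in>K. f (t, a) \<in> W}"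
proof -
  let ?B = "prod_topology (top_of_set K) A"
  have "continuous_map ?B (prod_topology (top_of_set unit_interval) A) (\<lambda>z. (fst z, snd z))"
  proof (intro continuous_map_pairedI continuous_map_snd)
    have "continuous_map ?B (top_of_set K) fst"
      by (rule continuous_map_fst)
    then show "continuous_map ?B (top_of_set unit_interval) fst"
      using K(2) by (auto simp: continuous_map_in_subtopology)
  qed
  from continuous_map_compose[OF this f] have "continuous_map ?B Q f"
    by (simp add: o_def)
  then have "closedin ?B {z \<in> topspace ?B. f z \<in> topspace Q - W}"
    using W by (intro closedin_continuous_map_preimage) auto
  moreover have "closed_map ?B A snd"
    using K by (intro Abstract_Topological_Spaces.closed_map_snd) (simp add: compact_space_subtopology)
  ultimately have closed: "closedin A (snd ` {z \<in> topspace ?B. f z \<in> topspace Q - W})"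
    by (simp add: closed_map_def)
  have "f (t, a) \<in> topspace Q" if "t \<in> K" "a \<in> topspace A" for t a
    using f K that by (auto simp: continuous_map_def Pi_iff)
  then have eq: "{a \<in> topspace A. \<forall>t\<in>K. f (t, a) \<in> W}
      = topspace A - snd ` {z \<in> topspace ?B. f z \<in> topspace Q - W}"
    by (auto simp: image_iff)
  show ?thesis
    using closed unfolding eq by (intro openin_diff openin_topspace)
qed

text \<open>Local compactness of the interval is the reason: near \<open>(t, a)\<close> the slice
  through \<open>a\<close> stays in \<open>W\<close> over a small closed ball, and the tube over
  that compact ball is an open neighbourhood of \<open>a\<close>.\<close>

lemma continuous_map_tubes:
  assumes f: "\<And>a. a \<in> topspace A \<Longrightarrow> pathin Q (\<lambda>t. f (t, a))"
    and tube: "\<And>K W. \<lbrakk>compact K; K \<subseteq> unit_interval; openin Q W\<rbrakk>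
      \<Longrightarrow> openin A {a \<in> topspace A. \<forall>t\<in>K. f (t, a) \<in> W}"
  shows "continuous_map (prod_topology (top_of_set unit_interval) A) Q f"
  unfolding continuous_map_def
proof (intro conjI allI impI)
  show "f \<in> topspace (prod_topology (top_of_set unit_interval) A) \<rightarrow> topspace Q"
    using f by (force simp: pathin_def continuous_map_def)
  fix W assume W: "openin Q W"
  show "openin (prod_topology (top_of_set unit_interval) A)
      {x \<in> topspace (prod_topology (top_of_set unit_interval) A). f x \<in> W}" (is "openin _ ?S")
    unfolding openin_prod_topology_alt
  proof (intro allI impI)
    fix t a assume "(t, a) \<in> ?S"
    then have t: "t \<in> unit_interval" and a: "a \<in> topspace A" and ta: "f (t, a) \<in> W"
      by auto
    have "openin (top_of_set unit_interval) {t \<in> unit_interval. f (t, a) \<in> W}"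
      using openin_continuous_map_preimage[OF f[OF a, unfolded pathin_def] W] by simp
    with t ta obtain e where e: "e > 0" "cball t e \<inter> unit_interval \<subseteq> {t \<in> unit_interval. f (t, a) \<in> W}"
      unfolding openin_contains_cball by blast
    let ?K = "cball t e \<inter> unit_interval"
    let ?V = "{a \<in> topspace A. \<forall>t\<in>?K. f (t, a) \<in> W}"
    show "\<exists>U V. openin (top_of_set unit_interval) U \<and> openin A V \<and> t \<in> U \<and> a \<in> V \<and> U \<times> V \<subseteq> ?S"
    proof (intro exI conjI)
      show "openin (top_of_set unit_interval) (unit_interval \<inter> ball t e)"
        by (simp add: openin_open_Int)
      show "openin A ?V"
        by (intro tube W compact_Int) auto
      show "a \<in> ?V"
        using a e(2) by blast
      show "(unit_interval \<inter> ball t e) \<times> ?V \<subseteq> ?S"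
        by auto
    qed (use t e in auto)
  qed
qed

text \<open>The product of the unit interval with a delta-generated space has no more open sets than
  its paths detect, so joint continuity may be tested on the squares traced by paths.\<close>

lemma continuous_map_test_squares:
  assumes A: "delta_generated A"
    and f: "\<And>g. pathin A g \<Longrightarrow>
      continuous_map (prod_topology (top_of_set unit_interval) (top_of_set unit_interval)) Q (\<lambda>(t, s). f (t, g s))"
  shows "continuous_map (prod_topology (top_of_set unit_interval) A) Q f"
proof (rule continuous_map_tubes)
  fix a assume "a \<in> topspace A"
  then have "pathin A (\<lambda>s. a)"
    by simp
  from f[OF this] have "continuous_map (top_of_set unit_interval) Q ((\<lambda>(t, s). f (t, a)) \<circ> (\<lambda>t. (t, 0::real)))"
    by (rule continuous_map_compose[rotated]) (auto intro!: continuous_intros continuous_map_pairedI)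
  then show "pathin Q (\<lambda>t. f (t, a))"
    by (simp add: pathin_def o_def)
next
  fix K W assume K: "compact K" "K \<subseteq> unit_interval" and W: "openin Q W"
  have "delta_open A {a \<in> topspace A. \<forall>t\<in>K. f (t, a) \<in> W}"
  proof (intro conjI allI impI)
    fix g assume g: "pathin A g"
    have "openin (top_of_set unit_interval)
        {s \<in> topspace (top_of_set unit_interval). \<forall>t\<in>K. (\<lambda>(t, s). f (t, g s)) (t, s) \<in> W}"
      by (rule openin_tube[OF f[OF g] K W])
    moreover have "g t \<in> topspace A" if "t \<in> unit_interval" for t
      using g that by (auto simp: pathin_def continuous_map_def)
    ultimately show "openin (top_of_set unit_interval)
        {s \<in> unit_interval. g s \<in> {a \<in> topspace A. \<forall>t\<in>K. f (t, a) \<in> W}}"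
      by (simp cong: conj_cong)
  qed auto
  then show "openin A {a \<in> topspace A. \<forall>t\<in>K. f (t, a) \<in> W}"
    using A by (simp add: delta_generated_def)
qed

lemma topspace_compact_open_paths [simp]: "topspace (compact_open_paths X) = path_maps X"
proof -
  have "path_maps X = {g \<in> path_maps X. g ` {} \<subseteq> {}}" by simp
  moreover have "compactin (top_of_set unit_interval) {} \<and> openin X {}" by simp
  ultimately show ?thesis
    unfolding compact_open_paths_def topology_generated_by_topspace by blast
qed

text \<open>The exponential law for paths, for an arbitrary space \<open>A\<close>: preimages of
  subbasic sets are tubes, and tubes decide joint continuity.\<close>

lemma continuous_map_compact_open_paths:
  "continuous_map A (compact_open_paths X) g \<longleftrightarrow>
     g \<in> topspace A \<rightarrow> path_maps X \<and>
     continuous_map (prod_topology (top_of_set unit_interval) A) X (\<lambda>(t, a). g a t)" (is "?L \<longleftrightarrow> ?R")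
proof
  assume L: ?L
  then have g: "g \<in> topspace A \<rightarrow> path_maps X"
    using continuous_map_funspace by fastforce
  have "continuous_map (prod_topology (top_of_set unit_interval) A) X (\<lambda>(t, a). g a t)"
  proof (rule continuous_map_tubes)
    fix a assume "a \<in> topspace A"
    then show "pathin X (\<lambda>t. case (t, a) of (t, a) \<Rightarrow> g a t)"
      using g by (auto simp: path_maps_def)
  next
    fix K W assume K: "compact K" "K \<subseteq> unit_interval" and W: "openin X W"
    then have "openin (compact_open_paths X) {h \<in> path_maps X. h ` K \<subseteq> W}"
      unfolding compact_open_paths_def
      by (intro topology_generated_by_Basis) (auto simp: compactin_subtopology)
    from openin_continuous_map_preimage[OF L this]
    show "openin A {a \<in> topspace A. \<forall>t\<in>K. (case (t, a) of (t, a) \<Rightarrow> g a t) \<in> W}"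
      by (rule back_subst[where P = "openin A"]) (use g in auto)
  qed
  with g show ?R by blast
next
  assume R: ?R
  show ?L
    unfolding compact_open_paths_def
  proof (rule continuous_on_generated_topo)
    show "g ` topspace A \<subseteq> \<Union> {{g \<in> path_maps X. g ` K \<subseteq> U} |K U. compactin (top_of_set unit_interval) K \<and> openin X U}"
      using R topspace_compact_open_paths[of X]
      unfolding compact_open_paths_def topology_generated_by_topspace by blast
  next
    fix S assume "S \<in> {{g \<in> path_maps X. g ` K \<subseteq> U} |K U. compactin (top_of_set unit_interval) K \<and> openin X U}"
    then obtain K U where S: "S = {g \<in> path_maps X. g ` K \<subseteq> U}"
      and K: "compact K" "K \<subseteq> unit_interval" and U: "openin X U"
      by (auto simp: compactin_subtopology)
    have "openin A {a \<in> topspace A. \<forall>t\<in>K. (\<lambda>(t, a). g a t) (t, a) \<in> U}"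
      using R K U by (intro openin_tube) auto
    then show "openin A (g -` S \<inter> topspace A)"
      by (rule back_subst[where P = "openin A"]) (use R S in auto)
  qed
qed

section \<open>Quotients\<close>

lemma topspace_quotient_topology [simp]: "topspace (quotient_topology X R) = topspace X // R"
proof -
  have "{x \<in> topspace X. R `` {x} \<in> topspace X // R} = topspace X"
    by (auto simp: quotientI)
  then have "openin (quotient_topology X R) (topspace X // R)"
    by (simp add: openin_quotient_topology)
  then show ?thesis
    unfolding topspace_def[of "quotient_topology X R"] openin_quotient_topology by blast
qed

lemma continuous_map_to_quotient: "continuous_map X (quotient_topology X R) (\<lambda>x. R `` {x})"
  by (auto simp: continuous_map_def openin_quotient_topology quotientI)

lemma continuous_map_from_quotient:
  assumes "continuous_map X Z (\<lambda>x. g (R `` {x}))"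
  shows "continuous_map (quotient_topology X R) Z g"
  unfolding continuous_map_def
proof (intro conjI allI impI)
  show "g \<in> topspace (quotient_topology X R) \<rightarrow> topspace Z"
    using assms by (auto simp: continuous_map_def quotient_def)
  fix U assume "openin Z U"
  with assms have "openin X {x \<in> topspace X. g (R `` {x}) \<in> U}"
    by (simp add: continuous_map_def)
  moreover have "{x \<in> topspace X. R `` {x} \<in> {c \<in> topspace X // R. g c \<in> U}} = {x \<in> topspace X. g (R `` {x}) \<in> U}"
    by (auto simp: quotientI)
  ultimately show "openin (quotient_topology X R) {c \<in> topspace (quotient_topology X R). g c \<in> U}"
    by (auto simp: openin_quotient_topology)
qed

section \<open>Weak homotopy equivalences\<close>

text \<open>Serves both path components and homotopy groups, whose induced maps take the image of a
  whole class and close it under the target relation. On classes this is \<open>F\<close> of any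
  representative, with inverse induced by \<open>G\<close>.\<close>

lemma bij_betw_quotient:
  assumes A: "equiv A E" and B: "equiv B E'"
    and F: "\<And>x y. (x, y) \<in> E \<Longrightarrow> (F x, F y) \<in> E'"
    and G: "\<And>x y. (x, y) \<in> E' \<Longrightarrow> (G x, G y) \<in> E"
    and GF: "\<And>x. x \<in> A \<Longrightarrow> (G (F x), x) \<in> E"
    and FG: "\<And>y. y \<in> B \<Longrightarrow> (F (G y), y) \<in> E'"
  shows "bij_betw (\<lambda>c. E' `` (F ` c)) (A // E) (B // E')"
proof -
  have cls: "E' `` (F ` (E `` {x})) = E' `` {F x}" if "x \<in> A" for x
  proof -
    have "(x, x) \<in> E" using A that by (simp add: equiv_def refl_on_def)
    moreover have "E' `` {F y} = E' `` {F x}" if "(x, y) \<in> E" for y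
      using equiv_class_eq[OF B F[OF that]] by simp
    ultimately show ?thesis by blast
  qed
  have FB: "F x \<in> B" if "x \<in> A" for x
    using F[of x x] equiv_class_eq_iff[OF A] equiv_class_eq_iff[OF B] that by blast
  have GA: "G y \<in> A" if "y \<in> B" for y
    using G[of y y] equiv_class_eq_iff[OF A] equiv_class_eq_iff[OF B] that by blast
  show ?thesis
    unfolding bij_betw_def
  proof
    show "inj_on (\<lambda>c. E' `` (F ` c)) (A // E)"
    proof (rule inj_onI)
      fix c d assume "c \<in> A // E" "d \<in> A // E" and eq: "E' `` (F ` c) = E' `` (F ` d)"
      then obtain x y where x: "x \<in> A" "c = E `` {x}" and y: "y \<in> A" "d = E `` {y}"
        by (auto elim!: quotientE)
      then have "(F x, F y) \<in> E'"
        using eq cls FB eq_equiv_class[OF _ B] by metis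
      then have "(G (F x), G (F y)) \<in> E"
        by (rule G)
      then have "E `` {x} = E `` {y}"
        using equiv_class_eq[OF A] GF x(1) y(1) by metis
      then show "c = d" using x y by simp
    qed
    show "(\<lambda>c. E' `` (F ` c)) ` (A // E) = B // E'"
    proof (intro equalityI subsetI)
      fix d assume "d \<in> (\<lambda>c. E' `` (F ` c)) ` (A // E)"
      then obtain x where "x \<in> A" "d = E' `` (F ` (E `` {x}))"
        by (auto elim!: quotientE)
      then show "d \<in> B // E'" using cls FB by (auto intro: quotientI)
    next
      fix d assume "d \<in> B // E'"
      then obtain y where y: "y \<in> B" "d = E' `` {y}"
        by (auto elim!: quotientE)
      then have "d = E' `` (F ` (E `` {G y}))"
        using cls GA FG equiv_class_eq[OF B] by metis
      then show "d \<in> (\<lambda>c. E' `` (F ` c)) ` (A // E)"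
        using GA y(1) by (auto intro!: quotientI)
    qed
  qed
qed

lemma equiv_spheroid_homotopy: "equiv (spheroids n X x) (spheroid_homotopy n X x)"
proof (rule equivI)
  show "spheroid_homotopy n X x \<subseteq> spheroids n X x \<times> spheroids n X x"
    by (auto simp: spheroid_homotopy_def)
  show "refl_on (spheroids n X x) (spheroid_homotopy n X x)"
    by (auto simp: refl_on_def spheroid_homotopy_def spheroids_def)
  show "sym (spheroid_homotopy n X x)"
    by (auto simp: sym_def spheroid_homotopy_def intro: homotopic_with_symD)
  show "trans (spheroid_homotopy n X x)"
    unfolding trans_def spheroid_homotopy_def by (blast intro: homotopic_with_trans)
qed

lemma compose_eq_on [simp]: "z \<in> S \<Longrightarrow> compose S f s z = f (s z)"
  by (simp add: compose_def)

lemma cube_boundary_subset: "cube_boundary n \<subseteq> topspace (cube n)"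
  by (auto simp: cube_boundary_def)

lemma compose_spheroid:
  assumes "continuous_map X Y f" "s \<in> spheroids n X x"
  shows "compose (topspace (cube n)) f s \<in> spheroids n Y (f x)"
proof -
  have "continuous_map (cube n) Y (f \<circ> s)"
    using assms by (auto simp: spheroids_def intro: continuous_map_compose)
  then have "continuous_map (cube n) Y (compose (topspace (cube n)) f s)"
    by (rule continuous_map_eq) simp
  then show ?thesis
    using assms cube_boundary_subset by (fastforce simp: spheroids_def)
qed

lemma compose_spheroid_homotopy:
  assumes f: "continuous_map X Y f" and st: "(s, t) \<in> spheroid_homotopy n X x"
  shows "(compose (topspace (cube n)) f s, compose (topspace (cube n)) f t) \<in> spheroid_homotopy n Y (f x)"
proof -
  have "homotopic_with (\<lambda>h. \<forall>z\<in>cube_boundary n. h z = f x) (cube n) Y (f \<circ> s) (f \<circ> t)"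
    by (rule homotopic_with_compose_continuous_map_left[OF _ f, where p = "\<lambda>h. \<forall>z\<in>cube_boundary n. h z = x"])
      (use st in \<open>auto simp: spheroid_homotopy_def\<close>)
  then have "homotopic_with (\<lambda>h. \<forall>z\<in>cube_boundary n. h z = f x) (cube n) Y
      (compose (topspace (cube n)) f s) (compose (topspace (cube n)) f t)"
    by (rule homotopic_with_eq) (use subsetD[OF cube_boundary_subset] in auto)
  then show ?thesis
    using st compose_spheroid[OF f] by (auto simp: spheroid_homotopy_def)
qed

text \<open>Having a homotopy inverse relative to every base point spares the usual change of base
  point.\<close>

lemma pointed_homotopy_equivalences_imp_weak:
  assumes f: "continuous_map X Y f" and surj: "f ` topspace X = topspace Y"
    and inv: "\<And>x. x \<in> topspace X \<Longrightarrow> \<exists>g. continuous_map Y X g \<and> g (f x) = x \<and>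
      (\<forall>y\<in>topspace Y. f (g y) = y) \<and> homotopic_with (\<lambda>h. h x = x) X X (g \<circ> f) id"
  shows "weak_homotopy_equivalence_map X Y f"
  unfolding weak_homotopy_equivalence_map_def
proof (intro conjI ballI allI impI)
  show "bij_betw (\<lambda>A. \<Union>x\<in>A. path_component_of_set Y (f x)) (path_components_of X) (path_components_of Y)"
  proof (cases "topspace X = {}")
    case True
    then show ?thesis using surj by (simp add: path_components_of_def bij_betw_def)
  next
    case False
    \<comment> \<open>Path components do not see the base point, so the inverse at any one point
      serves.\<close>
    then obtain x0 g where g: "continuous_map Y X g" "\<And>y. y \<in> topspace Y \<Longrightarrow> f (g y) = y"
      and hom: "homotopic_with (\<lambda>h. h x0 = x0) X X (g \<circ> f) id"
      using inv by (metis ex_in_conv)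
    have eqE: "equiv (topspace X) {(x, y). path_component_of X x y}"
      "equiv (topspace Y) {(x, y). path_component_of Y x y}"
      by (auto intro!: equivI simp: refl_on_def sym_def trans_def path_component_of_refl
          intro: path_component_of_sym path_component_of_trans path_component_in_topspace
          dest: path_component_in_topspace)
    have quot: "path_components_of X = topspace X // {(x, y). path_component_of X x y}"
      "path_components_of Y = topspace Y // {(x, y). path_component_of Y x y}"
      by (auto simp: path_components_of_def quotient_def image_iff)
    \<comment> \<open>The track of \<open>x\<close> under the homotopy is the required path.\<close>
    have GF: "path_component_of X (g (f x)) x" if x: "x \<in> topspace X" for x
    proof -
      obtain h where h: "continuous_map (prod_topology (top_of_set unit_interval) X) X h"
        "\<And>x. h (0, x) = (g \<circ> f) x" "\<And>x. h (1, x) = id x"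
        using hom unfolding homotopic_with_def by blast
      have "continuous_map (top_of_set unit_interval) (prod_topology (top_of_set unit_interval) X) (\<lambda>t. (t, x))"
        using x by (intro continuous_map_pairedI) auto
      from continuous_map_compose[OF this h(1)] have "pathin X (\<lambda>t. h (t, x))"
        by (simp add: pathin_def o_def)
      then show ?thesis
        unfolding path_component_of_def using h(2,3) by (metis comp_apply id_apply)
    qed
    have "bij_betw (\<lambda>c. {(x, y). path_component_of Y x y} `` (f ` c))
        (path_components_of X) (path_components_of Y)"
      unfolding quot
      by (rule bij_betw_quotient[where G = g])
        (use eqE f g GF in \<open>auto intro: path_component_of_continuous_image simp: path_component_of_refl\<close>)
    moreover have "(\<lambda>c. {(x, y). path_component_of Y x y} `` (f ` c)) = (\<lambda>A. \<Union>x\<in>A. path_component_of_set Y (f x))"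
      by auto
    ultimately show ?thesis by simp
  qed
next
  fix x n assume x: "x \<in> topspace X"
  then obtain g where g: "continuous_map Y X g" "g (f x) = x" "\<And>y. y \<in> topspace Y \<Longrightarrow> f (g y) = y"
      and hom: "homotopic_with (\<lambda>h. h x = x) X X (g \<circ> f) id"
    using inv by metis
  let ?C = "topspace (cube n)"
  show "bij_betw (homotopy_group_map n Y f x) (homotopy_group n X x) (homotopy_group n Y (f x))"
    unfolding homotopy_group_map_def homotopy_group_def
  proof (rule bij_betw_quotient[where G = "compose ?C g"])
    fix s assume s: "s \<in> spheroids n X x"
    have "homotopic_with (\<lambda>h. \<forall>z\<in>cube_boundary n. h z = x) (cube n) X ((g \<circ> f) \<circ> s) (id \<circ> s)"
      using s by (intro homotopic_with_compose_continuous_map_right[OF hom]) (auto simp: spheroids_def)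
    then have "homotopic_with (\<lambda>h. \<forall>z\<in>cube_boundary n. h z = x) (cube n) X (compose ?C g (compose ?C f s)) s"
      by (rule homotopic_with_eq) (use subsetD[OF cube_boundary_subset] in auto)
    moreover have "compose ?C g (compose ?C f s) \<in> spheroids n X x"
      using compose_spheroid[OF g(1) compose_spheroid[OF f s]] g(2) by simp
    ultimately show "(compose ?C g (compose ?C f s), s) \<in> spheroid_homotopy n X x"
      using s by (auto simp: spheroid_homotopy_def)
  next
    fix s assume s: "s \<in> spheroids n Y (f x)"
    \<comment> \<open>\<open>g\<close> is a strict section of \<open>f\<close>, so \<open>s\<close>
      itself is recovered, not merely a homotopic spheroid; extensionality turns agreement on the
      cube into equality.\<close>
    then have "compose ?C f (compose ?C g s) = s"
      using g(3) by (intro extensionalityI[where A = ?C])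
        (auto simp: spheroids_def continuous_map_def)
    then show "(compose ?C f (compose ?C g s), s) \<in> spheroid_homotopy n Y (f x)"
      using s equiv_spheroid_homotopy[of n Y "f x"] by (simp add: equiv_def refl_on_def)
  next
    fix s t assume "(s, t) \<in> spheroid_homotopy n Y (f x)"
    from compose_spheroid_homotopy[OF g(1) this] g(2)
    show "(compose ?C g s, compose ?C g t) \<in> spheroid_homotopy n X x" by simp
  qed (rule equiv_spheroid_homotopy compose_spheroid_homotopy[OF f] | assumption)+
qed (rule f)

section \<open>Spaces of directed paths\<close>

lemma square_topology:
  "prod_topology (top_of_set S) (top_of_set T) = top_of_set (S \<times> T)"
  by (simp add: prod_topology_subtopology_eu)

lemma topspace_dpath_space_between:
  assumes "dpaths X \<subseteq> path_maps (dtop X)"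
  shows "topspace (dpath_space_between X \<alpha> \<beta>) = {u \<in> dpaths X. u 0 = \<alpha> \<and> u 1 = \<beta>}"
  using assms by (auto simp: dpath_space_between_def dpath_space_def)

lemma delta_generated_dpath_space_between: "delta_generated (dpath_space_between X \<alpha> \<beta>)"
  by (simp add: dpath_space_between_def delta_generated_delta_kelleyfication)

text \<open>As \<open>A\<close> is delta-generated, both kelleyfications in the definition can be
  ignored, and the exponential law applies.\<close>

lemma continuous_map_into_dpath_space_between:
  assumes "dpaths X \<subseteq> path_maps (dtop X)" and "delta_generated A"
  shows "continuous_map A (dpath_space_between X \<alpha> \<beta>) g \<longleftrightarrow>
    g \<in> topspace A \<rightarrow> topspace (dpath_space_between X \<alpha> \<beta>) \<and>
    continuous_map (prod_topology (top_of_set unit_interval) A) (dtop X) (\<lambda>(t, a). g a t)"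
  using assms unfolding dpath_space_between_def dpath_space_def
  by (auto simp: continuous_map_into_delta_kelleyfication continuous_map_in_subtopology
      continuous_map_compact_open_paths)

text \<open>A path of paths is a map on a square, with \<open>t\<close> the time along a directed
  path and \<open>s\<close> the parameter of the family.\<close>

lemma pathin_dpath_space_between:
  assumes "dpaths X \<subseteq> path_maps (dtop X)"
  shows "pathin (dpath_space_between X \<alpha> \<beta>) g \<longleftrightarrow>
    g \<in> unit_interval \<rightarrow> topspace (dpath_space_between X \<alpha> \<beta>) \<and>
    continuous_map (top_of_set (unit_interval \<times> unit_interval)) (dtop X) (\<lambda>(t, s). g s t)"
  unfolding pathin_def
  by (subst continuous_map_into_dpath_space_between[OF assms])
    (auto simp: convex_imp_delta_generated square_topology)

text \<open>If \<open>x s\<close> and \<open>y r\<close> differ, the point \<open>x s\<close> is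
  closed, being the image of a constant path, so \<open>y\<close> avoids it on a closed interval
  around \<open>r\<close>. The image of that interval under \<open>y\<close> is closed as well, so
  \<open>x\<close> avoids it near \<open>s\<close>.\<close>

lemma closed_coincidence:
  assumes X: "delta_Hausdorff X" and x: "pathin X x" and y: "pathin X y"
  shows "closedin (top_of_set (unit_interval \<times> unit_interval)) {(s, r) \<in> unit_interval \<times> unit_interval. x s = y r}"
proof -
  let ?I = "top_of_set unit_interval"
  have "openin (prod_topology ?I ?I) {(s, r) \<in> unit_interval \<times> unit_interval. x s \<noteq> y r}"
    unfolding openin_prod_topology_alt
  proof (intro allI impI)
    fix s r assume "(s, r) \<in> {(s, r) \<in> unit_interval \<times> unit_interval. x s \<noteq> y r}"
    then have s: "s \<in> unit_interval" and r: "r \<in> unit_interval" and ne: "x s \<noteq> y r"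
      by auto
    have xs: "x s \<in> topspace X"
      using x s by (auto simp: pathin_def continuous_map_def)
    then have "pathin X (\<lambda>_. x s)"
      by simp
    then have "closedin X ((\<lambda>_. x s) ` unit_interval)"
      using X unfolding delta_Hausdorff_def by blast
    then have "openin X (topspace X - {x s})"
      by (simp add: image_constant_conv openin_diff)
    from openin_continuous_map_preimage[OF y[unfolded pathin_def] this]
    have "openin ?I {r \<in> unit_interval. y r \<in> topspace X - {x s}}"
      by simp
    moreover have "r \<in> {r \<in> unit_interval. y r \<in> topspace X - {x s}}"
      using r ne y by (auto simp: pathin_def continuous_map_def)
    ultimately obtain e where e: "e > 0"
      "cball r e \<inter> unit_interval \<subseteq> {r \<in> unit_interval. y r \<in> topspace X - {x s}}"
      unfolding openin_contains_cball by blast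
    \<comment> \<open>\<open>c\<close> clamps the unit interval onto the closed interval about
      \<open>r\<close>, so that this piece of \<open>y\<close> has the image of a full path.\<close>
    define c where "c t = max (max 0 (r - e)) (min (min 1 (r + e)) t)" for t :: real
    have c_im: "c ` unit_interval = cball r e \<inter> unit_interval"
    proof
      show "c ` unit_interval \<subseteq> cball r e \<inter> unit_interval"
        using r e(1) by (auto simp: c_def dist_real_def)
      have "c t = t" if "t \<in> cball r e \<inter> unit_interval" for t
        using that by (auto simp: c_def dist_real_def)
      then show "cball r e \<inter> unit_interval \<subseteq> c ` unit_interval"
        by (metis (no_types, lifting) IntE image_eqI subsetI)
    qed
    have "continuous_map ?I ?I c"
      using c_im by (auto simp: c_def intro!: continuous_intros)
    from continuous_map_compose[OF this y[unfolded pathin_def]] have "pathin X (y \<circ> c)"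
      by (simp add: pathin_def)
    then have "closedin X (y ` (cball r e \<inter> unit_interval))"
      using X c_im unfolding delta_Hausdorff_def by (metis image_comp)
    then have "openin X (topspace X - y ` (cball r e \<inter> unit_interval))"
      by blast
    from openin_continuous_map_preimage[OF x[unfolded pathin_def] this]
    have U: "openin ?I {s \<in> unit_interval. x s \<in> topspace X - y ` (cball r e \<inter> unit_interval)}"
      by simp
    show "\<exists>U V. openin ?I U \<and> openin ?I V \<and> s \<in> U \<and> r \<in> V \<and>
        U \<times> V \<subseteq> {(s, r) \<in> unit_interval \<times> unit_interval. x s \<noteq> y r}"
    proof (intro exI conjI)
      show "openin ?I {s \<in> unit_interval. x s \<in> topspace X - y ` (cball r e \<inter> unit_interval)}"
        by (rule U)
      show "openin ?I (unit_interval \<inter> ball r e)"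
        by (simp add: openin_open_Int)
      show "s \<in> {s \<in> unit_interval. x s \<in> topspace X - y ` (cball r e \<inter> unit_interval)}"
        using s xs e(2) by auto
      show "{s \<in> unit_interval. x s \<in> topspace X - y ` (cball r e \<inter> unit_interval)} \<times> (unit_interval \<inter> ball r e)
          \<subseteq> {(s, r) \<in> unit_interval \<times> unit_interval. x s \<noteq> y r}"
      proof clarify
        fix s' r' assume s': "s' \<in> unit_interval" "x s' \<notin> y ` (cball r e \<inter> unit_interval)"
          and r': "r' \<in> unit_interval" "r' \<in> ball r e"
        then have "r' \<in> cball r e \<inter> unit_interval"
          by simp
        then have "x s' \<noteq> y r'"
          using s'(2) by blast
        then show "(s', r') \<in> unit_interval \<times> unit_interval \<and> x s' \<noteq> y r'"
          using s'(1) r'(1) by simp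
      qed
    qed (use r e(1) in auto)
  qed
  then have ne: "openin (top_of_set (unit_interval \<times> unit_interval)) {(s, r) \<in> unit_interval \<times> unit_interval. x s \<noteq> y r}"
    by (simp only: square_topology)
  have eq: "{(s, r) \<in> unit_interval \<times> unit_interval. x s = y r}
      = unit_interval \<times> unit_interval - {(s, r) \<in> unit_interval \<times> unit_interval. x s \<noteq> y r}"
    by auto
  show ?thesis
    unfolding eq using ne by (intro closedin_diff) auto
qed

text \<open>The complement of the image of \<open>g\<close> is tested on a path \<open>h\<close>.
  The parameters where \<open>h\<close> meets the image are the projection of the set of
  \<open>(s, r)\<close> at which \<open>h s\<close> and \<open>g r\<close> agree at every time; as
  an intersection of closed coincidence sets in the square, this set is compact.\<close>

lemma delta_Hausdorff_dpath_space_between: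
  assumes X: "dpaths X \<subseteq> path_maps (dtop X)" and H: "delta_Hausdorff (dtop X)"
  shows "delta_Hausdorff (dpath_space_between X \<alpha> \<beta>)"
  unfolding delta_Hausdorff_def
proof (intro allI impI)
  let ?P = "dpath_space_between X \<alpha> \<beta>"
  let ?I2 = "unit_interval \<times> unit_interval"
  fix g assume g: "pathin ?P g"
  have at_time: "pathin (dtop X) (\<lambda>s. h s t)" if "pathin ?P h" "t \<in> unit_interval" for h t
  proof -
    have "continuous_map (top_of_set unit_interval) (top_of_set ?I2) (\<lambda>s. (t, s))"
      using that(2) by (auto intro!: continuous_intros)
    moreover have "continuous_map (top_of_set ?I2) (dtop X) (\<lambda>(t, s). h s t)"
      using that(1) pathin_dpath_space_between[OF X] by blast
    ultimately have "continuous_map (top_of_set unit_interval) (dtop X) ((\<lambda>(t, s). h s t) \<circ> (\<lambda>s. (t, s)))"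
      by (rule continuous_map_compose)
    then show ?thesis
      by (simp add: pathin_def o_def)
  qed
  have P_ext: "u \<in> extensional unit_interval" if "u \<in> topspace ?P" for u
    using that X topspace_dpath_space_between[OF X] by (auto simp: path_maps_def)
  have im: "h s \<in> topspace ?P" if "pathin ?P h" "s \<in> unit_interval" for h s
    using that by (auto simp: pathin_def continuous_map_def)
  have "delta_open ?P (topspace ?P - g ` unit_interval)"
  proof (intro conjI allI impI)
    fix h assume h: "pathin ?P h"
    let ?C = "\<lambda>t. {(s, r) \<in> ?I2. h s t = g r t}"
    have "closedin (top_of_set ?I2) (\<Inter>t\<in>unit_interval. ?C t)"
    proof (rule closedin_Inter)
      fix C assume "C \<in> ?C ` unit_interval"
      then obtain t where "t \<in> unit_interval" "C = ?C t"
        by blast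
      then show "closedin (top_of_set ?I2) C"
        using closed_coincidence[OF H at_time[OF h] at_time[OF g]] by simp
    qed simp
    then have "compact (\<Inter>t\<in>unit_interval. ?C t)"
      using closedin_compact compact_Times compact_Icc by blast
    have "(\<Inter>t\<in>unit_interval. ?C t) \<subseteq> ?C 0"
      by (rule INT_lower) simp
    then have "fst ` (\<Inter>t\<in>unit_interval. ?C t) \<subseteq> unit_interval"
      by auto
    with \<open>compact _\<close> have "closedin (top_of_set unit_interval) (fst ` (\<Inter>t\<in>unit_interval. ?C t))"
      by (intro closed_subset compact_imp_closed compact_continuous_image continuous_intros)
    moreover have "fst ` (\<Inter>t\<in>unit_interval. ?C t) = {s \<in> unit_interval. h s \<in> g ` unit_interval}"
    proof (intro equalityI subsetI)
      fix s assume "s \<in> fst ` (\<Inter>t\<in>unit_interval. ?C t)"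
      then obtain z where z: "z \<in> (\<Inter>t\<in>unit_interval. ?C t)" "s = fst z"
        by blast
      define r where "r = snd z"
      have r: "(s, r) \<in> ?C t" if "t \<in> unit_interval" for t
        using INT_D[OF z(1) that] z(2) by (auto simp: r_def)
      from r[of 0] have sr: "s \<in> unit_interval" "r \<in> unit_interval"
        by auto
      then have "h s = g r"
        using r by (intro extensionalityI[where A = unit_interval] P_ext im h g) auto
      then show "s \<in> {s \<in> unit_interval. h s \<in> g ` unit_interval}"
        using sr by auto
    next
      fix s assume "s \<in> {s \<in> unit_interval. h s \<in> g ` unit_interval}"
      then obtain r where "s \<in> unit_interval" "r \<in> unit_interval" "h s = g r" by auto
      then have "(s, r) \<in> (\<Inter>t\<in>unit_interval. ?C t)" by auto
      then show "s \<in> fst ` (\<Inter>t\<in>unit_interval. ?C t)"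
        by (metis (no_types, lifting) fst_conv image_eqI)
    qed
    ultimately have "closedin (top_of_set unit_interval) {s \<in> unit_interval. h s \<in> g ` unit_interval}"
      by (simp only:)
    then have "openin (top_of_set unit_interval) (unit_interval - {s \<in> unit_interval. h s \<in> g ` unit_interval})"
      by (intro openin_diff) auto
    then show "openin (top_of_set unit_interval) {s \<in> unit_interval. h s \<in> topspace ?P - g ` unit_interval}"
      by (rule back_subst[where P = "openin (top_of_set unit_interval)"]) (use im[OF h] in auto)
  qed auto
  then have "openin ?P (topspace ?P - g ` unit_interval)"
    by (rule delta_generatedD[OF delta_generated_dpath_space_between])
  then show "closedin ?P (g ` unit_interval)"
    using im[OF g] by (auto simp: closedin_def)
qed

section \<open>Constant-speed representatives\<close>

lemma reparams0D:
  assumes "\<phi> \<in> reparams0"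
  shows "continuous_on unit_interval \<phi>" "\<And>t. t \<in> unit_interval \<Longrightarrow> \<phi> t \<in> unit_interval"
    "mono_on unit_interval \<phi>" "\<phi> 0 = 0" "\<phi> 1 = 1" "\<phi> \<in> reparams"
  using assms by (auto simp: reparams0_def reparams_def image_subset_iff)

lemma reparams0_surj:
  assumes "\<phi> \<in> reparams0" "y \<in> unit_interval"
  obtains t where "t \<in> unit_interval" "\<phi> t = y"
  using IVT'[of \<phi> 0 y 1] reparams0D[OF assms(1)] assms(2) by auto

lemma reparams0_id: "(\<lambda>t. t) \<in> reparams0"
  by (auto simp: reparams0_def reparams_def mono_on_def)

text \<open>Convexity is what allows clocks to be deformed along straight lines with fixed end
  points.\<close>

lemma reparams0_convex:
  assumes \<phi>: "\<phi> \<in> reparams0" and \<psi>: "\<psi> \<in> reparams0" and r: "r \<in> unit_interval"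
  shows "(\<lambda>t. (1 - r) * \<phi> t + r * \<psi> t) \<in> reparams0"
proof -
  have "(1 - r) * \<phi> t + r * \<psi> t \<in> unit_interval" if "t \<in> unit_interval" for t
    using convexD_alt[of unit_interval "\<phi> t" "\<psi> t" r] reparams0D(2)[OF \<phi> that] reparams0D(2)[OF \<psi> that] r
    by simp
  moreover have "mono_on unit_interval (\<lambda>t. (1 - r) * \<phi> t + r * \<psi> t)"
    using reparams0D(3)[OF \<phi>] reparams0D(3)[OF \<psi>] r
    by (auto simp: mono_on_def intro!: add_mono mult_left_mono)
  ultimately show ?thesis
    using reparams0D[OF \<phi>] reparams0D[OF \<psi>]
    by (auto simp: reparams0_def reparams_def intro!: continuous_intros)
qed

section \<open>Uniqueness of lifts along the exponential map\<close>

lemma cis_eq_imp_int_multiple: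
  assumes "cis a = cis b"
  obtains n :: int where "a - b = 2 * pi * n"
proof -
  from assms obtain n :: int
    where "\<i> * complex_of_real a = \<i> * complex_of_real b + (of_int (2 * n) * pi) * \<i>"
    unfolding cis_conv_exp exp_eq by auto
  then have "Im (\<i> * complex_of_real a) = Im (\<i> * complex_of_real b + (of_int (2 * n) * pi) * \<i>)"
    by simp
  then show thesis
    by (intro that[of n]) simp
qed

text \<open>The difference of two lifts takes values in the multiples of \<open>2 * pi\<close>, a
  set with gaps, so it is constant on a connected set.\<close>

lemma cis_lift_unique:
  fixes l m :: "'a::topological_space \<Rightarrow> real"
  assumes S: "connected S" and l: "continuous_on S l" and m: "continuous_on S m"
    and eq: "\<And>t. t \<in> S \<Longrightarrow> cis (l t) = cis (m t)" and st: "s \<in> S" "t \<in> S"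
  shows "l s - m s = l t - m t"
proof -
  have "(\<lambda>t. l t - m t) constant_on S"
  proof (rule continuous_discrete_range_constant[OF S])
    show "continuous_on S (\<lambda>t. l t - m t)"
      by (intro continuous_intros l m)
    fix x assume x: "x \<in> S"
    show "\<exists>e>0. \<forall>y. y \<in> S \<and> l y - m y \<noteq> l x - m x \<longrightarrow> e \<le> norm (l y - m y - (l x - m x))"
    proof (intro exI[of _ "2 * pi"] conjI allI impI)
      fix y assume y: "y \<in> S \<and> l y - m y \<noteq> l x - m x"
      obtain a b :: int where ab: "l x - m x = 2 * pi * a" "l y - m y = 2 * pi * b"
        using cis_eq_imp_int_multiple[OF eq] x y by metis
      then have "a \<noteq> b" using y by auto
      then have "1 \<le> \<bar>real_of_int (b - a)\<bar>" by linarith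
      then have "2 * pi * 1 \<le> 2 * pi * \<bar>real_of_int (b - a)\<bar>"
        by (intro mult_left_mono) auto
      also have "\<dots> = norm (l y - m y - (l x - m x))"
        unfolding ab real_norm_def of_int_diff right_diff_distrib[symmetric] abs_mult by simp
      finally show "2 * pi \<le> norm (l y - m y - (l x - m x))" by simp
    qed simp
  qed
  then show ?thesis
    using st by (auto simp: constant_on_def)
qed

text \<open>\<open>E\<close> stands for the clock map followed by an embedding of the circle in the
  complex plane, so that lifting a clock means taking an argument and complex logarithms
  apply.\<close>

locale clocked_dspace =
  fixes X :: "'a dspace" and E :: "'a \<Rightarrow> complex" and \<alpha> \<beta> :: 'a
  assumes dpaths_path_maps: "dpaths X \<subseteq> path_maps (dtop X)"
    and dpaths_reparam: "\<lbrakk>u \<in> dpaths X; \<phi> \<in> reparams\<rbrakk> \<Longrightarrow> compose unit_interval u \<phi> \<in> dpaths X"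
    and saturated: "saturated X"
    and E_continuous: "continuous_map (dtop X) euclidean E"
    and E_lift: "u \<in> dpaths X \<Longrightarrow> \<exists>l. continuous_on unit_interval l \<and> mono_on unit_interval l \<and>
      (\<forall>t\<in>unit_interval. E (u t) = cis (l t))"
    and E_regular: "\<lbrakk>u \<in> dpaths X; (E \<circ> u) constant_on unit_interval\<rbrakk> \<Longrightarrow> u constant_on unit_interval"
begin

section \<open>Clocks and constant-speed representatives\<close>

abbreviation P where "P \<equiv> dpath_space_between X \<alpha> \<beta>"

lemmas topspace_P = topspace_dpath_space_between[OF dpaths_path_maps]

lemma topspace_PD:
  assumes "u \<in> topspace P"
  shows "u \<in> dpaths X" "u 0 = \<alpha>" "u 1 = \<beta>" "u \<in> extensional unit_interval"
  using assms dpaths_path_maps by (auto simp: topspace_P path_maps_def)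

text \<open>Lifts are unique up to a constant on the interval, and subtracting the initial value
  removes the dependence on the chosen one.\<close>

definition clock :: "(real \<Rightarrow> 'a) \<Rightarrow> real \<Rightarrow> real" where
  "clock u = (let l = SOME l. continuous_on unit_interval l \<and> mono_on unit_interval l \<and>
      (\<forall>t\<in>unit_interval. E (u t) = cis (l t)) in (\<lambda>t. l t - l 0))"

text \<open>The last clause accepts any continuous lift, so that the clock can be read off from a
  logarithm chosen on a whole square of paths.\<close>

lemma clock:
  assumes "u \<in> dpaths X"
  shows "continuous_on unit_interval (clock u)" "mono_on unit_interval (clock u)" "clock u 0 = 0"
    "\<And>t. t \<in> unit_interval \<Longrightarrow> E (u t) = E (u 0) * cis (clock u t)"
    "\<And>l t. \<lbrakk>continuous_on unit_interval l; \<And>t. t \<in> unit_interval \<Longrightarrow> E (u t) = cis (l t); t \<in> unit_interval\<rbrakk>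
      \<Longrightarrow> clock u t = l t - l 0"
proof -
  obtain m where m: "continuous_on unit_interval m" "mono_on unit_interval m"
      "\<forall>t\<in>unit_interval. E (u t) = cis (m t)" and clock_u: "clock u = (\<lambda>t. m t - m 0)"
    unfolding clock_def Let_def using someI_ex[OF E_lift[OF assms]] by blast
  show "continuous_on unit_interval (clock u)"
    unfolding clock_u by (intro continuous_on_diff continuous_on_const m(1))
  show "mono_on unit_interval (clock u)" "clock u 0 = 0"
    using m(2) by (auto simp: clock_u mono_on_def)
  show "E (u t) = E (u 0) * cis (clock u t)" if "t \<in> unit_interval" for t
    using m(3) that by (simp add: clock_u cis_mult)
  fix l t assume l: "continuous_on unit_interval l" "\<And>t. t \<in> unit_interval \<Longrightarrow> E (u t) = cis (l t)"
    and t: "t \<in> unit_interval"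
  have "m t - l t = m 0 - l 0"
    using m l t by (intro cis_lift_unique[of unit_interval]) auto
  then show "clock u t = l t - l 0"
    by (simp add: clock_u)
qed

text \<open>The clock of a path whose total clock time vanishes is constant, hence so is the path, and
  every reparametrization is as good as the identity.\<close>

definition norm_clock :: "(real \<Rightarrow> 'a) \<Rightarrow> real \<Rightarrow> real" where
  "norm_clock u = (if clock u 1 = 0 then (\<lambda>t. t) else (\<lambda>t. clock u t / clock u 1))"

lemma norm_clock_reparams0:
  assumes "u \<in> dpaths X"
  shows "norm_clock u \<in> reparams0"
proof (cases "clock u 1 = 0")
  case True
  then show ?thesis by (simp add: norm_clock_def reparams0_id)
next
  case False
  note c = clock(1-3)[OF assms]
  have bounds: "0 \<le> clock u t \<and> clock u t \<le> clock u 1" if "t \<in> unit_interval" for t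
    using c(3) mono_onD[OF c(2), of 0 t] mono_onD[OF c(2), of t 1] that by auto
  then have pos: "clock u 1 > 0"
    using False by (metis atLeastAtMost_iff le_numeral_extra(4) less_eq_real_def zero_le_one)
  show ?thesis
    using False pos bounds c
    by (auto simp: norm_clock_def reparams0_def reparams_def mono_on_def divide_right_mono
        intro!: continuous_intros)
qed

text \<open>Regularity speaks of whole paths, so the piece of \<open>u\<close> between
  \<open>s\<close> and \<open>t\<close> is stretched to one by an affine member of
  \<open>reparams\<close>. A monotone clock with equal values at \<open>s\<close> and
  \<open>t\<close> is constant between them.\<close>

lemma constant_on_clock_interval:
  assumes u: "u \<in> dpaths X" and st: "s \<in> unit_interval" "t \<in> unit_interval" "s \<le> t"
    and eq: "clock u s = clock u t"
  shows "u s = u t"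
proof -
  let ?\<phi> = "\<lambda>r. s + (t - s) * r"
  have im: "s \<le> ?\<phi> r \<and> ?\<phi> r \<le> t" if "r \<in> unit_interval" for r
    using that st(3) mult_left_le[of r "t - s"] by auto
  have "?\<phi> \<in> reparams"
    using st im by (force simp: reparams_def mono_on_def intro!: continuous_intros mult_left_mono)
  from dpaths_reparam[OF u this] have v: "compose unit_interval u ?\<phi> \<in> dpaths X" .
  have "clock u (?\<phi> r) = clock u s" if "r \<in> unit_interval" for r
    using im[OF that] mono_onD[OF clock(2)[OF u], of s "?\<phi> r"] mono_onD[OF clock(2)[OF u], of "?\<phi> r" t] st eq
    by auto
  then have "E (u (?\<phi> r)) = E (u 0) * cis (clock u s)" if "r \<in> unit_interval" for r
    using that im[OF that] st clock(4)[OF u, of "?\<phi> r"] by auto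
  then have "(E \<circ> compose unit_interval u ?\<phi>) constant_on unit_interval"
    unfolding constant_on_def by auto
  from E_regular[OF v this] obtain y where "\<forall>r\<in>unit_interval. compose unit_interval u ?\<phi> r = y"
    unfolding constant_on_def by auto
  from bspec[OF this, of 0] bspec[OF this, of 1] show ?thesis by simp
qed

lemma norm_clock_collapse:
  assumes u: "u \<in> dpaths X" and st: "s \<in> unit_interval" "t \<in> unit_interval"
    and eq: "norm_clock u s = norm_clock u t"
  shows "u s = u t"
proof -
  have "clock u s = clock u t"
    using eq by (auto simp: norm_clock_def split: if_splits)
  then show ?thesis
    using constant_on_clock_interval[OF u] st by (metis linear)
qed

text \<open>The chosen time does not matter for directed \<open>u\<close>: every fibre of
  \<open>norm_clock u\<close> is nonempty, and \<open>u\<close> is constant on it by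
  \<open>norm_clock_collapse\<close>.\<close>

definition natural :: "(real \<Rightarrow> 'a) \<Rightarrow> real \<Rightarrow> 'a" where
  "natural u = (\<lambda>y\<in>unit_interval. u (SOME t. t \<in> unit_interval \<and> norm_clock u t = y))"

lemma natural_norm_clock:
  assumes u: "u \<in> dpaths X" and t: "t \<in> unit_interval"
  shows "natural u (norm_clock u t) = u t"
proof -
  let ?s = "SOME s. s \<in> unit_interval \<and> norm_clock u s = norm_clock u t"
  have "?s \<in> unit_interval \<and> norm_clock u ?s = norm_clock u t"
    using t by (intro someI[where P = "\<lambda>s. s \<in> unit_interval \<and> norm_clock u s = norm_clock u t"]) auto
  then have "u ?s = u t"
    using norm_clock_collapse[OF u] t by blast
  then show ?thesis
    using reparams0D(2)[OF norm_clock_reparams0[OF u] t] by (simp add: natural_def)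
qed

lemma compose_natural_norm_clock:
  assumes "u \<in> topspace P"
  shows "compose unit_interval (natural u) (norm_clock u) = u"
  using topspace_PD[OF assms] natural_norm_clock
  by (intro extensionalityI[where A = unit_interval]) auto

text \<open>Individually chosen lifts need not fit together, so a common lift for the whole family
  is taken from a logarithm on the square. By uniqueness of lifts it computes the clock of each
  member.\<close>

lemma continuous_on_norm_clock:
  assumes g: "pathin P g"
  shows "continuous_on (unit_interval \<times> unit_interval) (\<lambda>(t, s). norm_clock (g s) t)"
proof -
  let ?I2 = "unit_interval \<times> unit_interval"
  have gP: "g s \<in> topspace P" if "s \<in> unit_interval" for s
    using g that by (auto simp: pathin_def continuous_map_def)
  have "continuous_map (top_of_set ?I2) (dtop X) (\<lambda>(t, s). g s t)"
    using g pathin_dpath_space_between[OF dpaths_path_maps] by blast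
  from continuous_map_compose[OF this E_continuous]
  have E_cont: "continuous_on ?I2 (\<lambda>(t, s). E (g s t))"
    by (simp add: o_def case_prod_unfold)
  have norm_E: "norm (E (g s t)) = 1" if "t \<in> unit_interval" "s \<in> unit_interval" for s t
    using E_lift[OF topspace_PD(1)[OF gP[OF that(2)]]] that(1) by (metis norm_cis)
  obtain L where L: "continuous_on ?I2 L" "\<And>z. z \<in> ?I2 \<Longrightarrow> (case z of (t, s) \<Rightarrow> E (g s t)) = exp (L z)"
  proof (rule continuous_logarithm_on_contractible[OF E_cont])
    show "contractible ?I2"
      by (intro convex_imp_contractible convex_Times convex_real_interval)
    fix z assume "z \<in> ?I2"
    then show "(case z of (t, s) \<Rightarrow> E (g s t)) \<noteq> 0"
      using norm_E by fastforce
  qed (rule that)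
  \<comment> \<open>\<open>E\<close> has modulus 1 along the family, so the imaginary part of the
    logarithm is a real lift.\<close>
  define l where "l t s = Im (L (t, s))" for t s
  have l_cont: "continuous_on ?I2 (\<lambda>(t, s). l t s)"
    using L(1) by (simp add: l_def case_prod_unfold continuous_on_Im)
  have E_l: "E (g s t) = cis (l t s)" if "t \<in> unit_interval" "s \<in> unit_interval" for t s
  proof -
    have "E (g s t) = exp (L (t, s))"
      using L(2)[of "(t, s)"] that by simp
    moreover from this have "Re (L (t, s)) = 0"
      using norm_E[OF that] by simp
    ultimately show ?thesis
      by (simp add: exp_eq_polar l_def)
  qed
  have slice1: "continuous_on unit_interval (\<lambda>t. l t s)" if "s \<in> unit_interval" for s
    using that by (intro continuous_on_compose2[OF l_cont, of unit_interval "\<lambda>t. (t, s)", simplified] continuous_intros) auto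
  have slice2: "continuous_on unit_interval (\<lambda>s. l t s)" if "t \<in> unit_interval" for t
    using that by (intro continuous_on_compose2[OF l_cont, of unit_interval "\<lambda>s. (t, s)", simplified] continuous_intros) auto
  have clock_l: "clock (g s) t = l t s - l 0 s" if "t \<in> unit_interval" "s \<in> unit_interval" for t s
  proof (rule clock(5)[where u = "g s" and l = "\<lambda>t. l t s" and t = t])
    show "E (g s r) = cis (l r s)" if "r \<in> unit_interval" for r
      using that \<open>s \<in> unit_interval\<close> by (rule E_l)
  qed (use that topspace_PD(1)[OF gP] slice1 in blast)+
  \<comment> \<open>All paths in \<open>P\<close> share their end points, so \<open>E\<close> is
    constant along the sides \<open>t = 0\<close> and \<open>t = 1\<close> of the square, and hence
    so is its lift.\<close>
  have ends: "l t s = l t 0" if t: "t = 0 \<or> t = 1" and s: "s \<in> unit_interval" for t s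
  proof -
    have tI: "t \<in> unit_interval"
      using t by auto
    have E_end: "E (g s' t) = E (g 0 t)" if "s' \<in> unit_interval" for s'
      using t topspace_PD(2,3)[OF gP[OF that]] topspace_PD(2,3)[OF gP[of 0]] by auto
    have "l t s - l t 0 = l t 0 - l t 0"
    proof (rule cis_lift_unique[of unit_interval "\<lambda>s. l t s" "\<lambda>_. l t 0"])
      show "cis (l t s') = cis (l t 0)" if "s' \<in> unit_interval" for s'
        using E_l[OF tI that] E_l[OF tI, of 0] E_end[OF that] by simp
    qed (use s slice2[OF tI] in auto)
    then show ?thesis by simp
  qed
  have total: "clock (g s) 1 = clock (g 0) 1" if "s \<in> unit_interval" for s
    using clock_l[of 1 s] clock_l[of 1 0] ends[of 0 s] ends[of 1 s] that by simp
  show ?thesis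
  \<comment> \<open>The total clock time does not depend on \<open>s\<close>, so the same branch of
    \<open>norm_clock\<close> applies to the whole family.\<close>
  proof (cases "clock (g 0) 1 = 0")
    case True
    then have "norm_clock (g s) t = t" if "s \<in> unit_interval" for s t
      using total[OF that] by (simp add: norm_clock_def)
    then have "continuous_on ?I2 (\<lambda>(t, s). norm_clock (g s) t) = continuous_on ?I2 fst"
      by (intro continuous_on_cong) auto
    then show ?thesis
      by (simp add: continuous_on_fst)
  next
    case False
    have "continuous_on ?I2 (\<lambda>(t, s). l 0 s)"
      unfolding case_prod_unfold by (intro continuous_on_compose2[OF slice2] continuous_intros) auto
    then have "continuous_on ?I2 (\<lambda>z. ((\<lambda>(t, s). l t s) z - (\<lambda>(t, s). l 0 s) z) / clock (g 0) 1)"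
      using l_cont by (intro continuous_intros) (use False in auto)
    moreover have "norm_clock (g s) t = (l t s - l 0 s) / clock (g 0) 1"
      if "t \<in> unit_interval" "s \<in> unit_interval" for s t
      using False total[OF that(2)] clock_l[OF that] by (simp add: norm_clock_def)
    ultimately show ?thesis
      by (elim continuous_on_eq) auto
  qed
qed

text \<open>The square is compact, so reparametrizing it by the clocks is a quotient map, along which the
  constant-speed representatives are continuous.\<close>

lemma continuous_map_natural:
  assumes g: "pathin P g"
  shows "continuous_map (top_of_set (unit_interval \<times> unit_interval)) (dtop X) (\<lambda>(t, s). natural (g s) t)"
proof -
  let ?I2 = "unit_interval \<times> unit_interval"
  have gD: "g s \<in> dpaths X" if "s \<in> unit_interval" for s
    using g that by (intro topspace_PD(1)) (auto simp: pathin_def continuous_map_def)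
  let ?\<theta> = "\<lambda>(t, s). (norm_clock (g s) t, s)"
  have "quotient_map (top_of_set ?I2) (top_of_set ?I2) ?\<theta>"
  proof (rule continuous_imp_quotient_map)
    have im: "?\<theta> ` ?I2 = ?I2"
    proof (intro equalityI subsetI)
      fix z assume "z \<in> ?\<theta> ` ?I2"
      then show "z \<in> ?I2"
        using reparams0D(2)[OF norm_clock_reparams0[OF gD]] by auto
    next
      fix z assume "z \<in> ?I2"
      then obtain y s where z: "z = (y, s)" "y \<in> unit_interval" "s \<in> unit_interval"
        by blast
      obtain t where "t \<in> unit_interval" "norm_clock (g s) t = y"
        using reparams0_surj[OF norm_clock_reparams0[OF gD]] z by blast
      then show "z \<in> ?\<theta> ` ?I2"
        using z by (intro image_eqI[of _ _ "(t, s)"]) auto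
    qed
    then show "?\<theta> ` topspace (top_of_set ?I2) = topspace (top_of_set ?I2)"
      by simp
    have "continuous_on ?I2 (\<lambda>z. ((\<lambda>(t, s). norm_clock (g s) t) z, snd z))"
      by (intro continuous_intros continuous_on_norm_clock g)
    then show "continuous_map (top_of_set ?I2) (top_of_set ?I2) ?\<theta>"
      using im by (auto simp: case_prod_unfold)
    show "compact_space (top_of_set ?I2)"
      by (simp add: compact_space_subtopology compact_Times)
    show "Hausdorff_space (top_of_set ?I2)"
      by (simp add: Hausdorff_space_subtopology)
  qed
  then show ?thesis
  proof (rule continuous_compose_quotient_map)
    \<comment> \<open>After reparametrization by the clocks only the evaluation of \<open>g\<close>
      remains.\<close>
    show "continuous_map (top_of_set ?I2) (dtop X) ((\<lambda>(t, s). natural (g s) t) \<circ> ?\<theta>)"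
    proof (rule continuous_map_eq)
      show "continuous_map (top_of_set ?I2) (dtop X) (\<lambda>(t, s). g s t)"
        using g pathin_dpath_space_between[OF dpaths_path_maps] by blast
    qed (use natural_norm_clock gD in auto)
  qed
qed

lemma natural_in_P:
  assumes u: "u \<in> topspace P"
  shows "natural u \<in> topspace P"
proof -
  \<comment> \<open>A constant family reduces the continuity of \<open>natural u\<close> to the
    result on squares.\<close>
  have "pathin P (\<lambda>s. u)"
    using u by simp
  from continuous_map_natural[OF this]
  have "continuous_map (top_of_set unit_interval) (dtop X) ((\<lambda>(t, s). natural u t) \<circ> (\<lambda>t. (t, 0::real)))"
    by (rule continuous_map_compose[rotated]) (auto intro!: continuous_intros)
  then have "pathin (dtop X) (natural u)"
    by (simp add: pathin_def o_def)
  moreover have "natural u \<in> extensional unit_interval"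
    by (simp add: natural_def)
  ultimately have "natural u \<in> path_maps (dtop X)"
    by (simp add: path_maps_def)
  moreover have "compose unit_interval (natural u) (norm_clock u) \<in> dpaths X"
    using compose_natural_norm_clock[OF u] topspace_PD[OF u] by simp
  ultimately have "natural u \<in> dpaths X"
    using saturated norm_clock_reparams0[OF topspace_PD(1)[OF u]] unfolding saturated_def by blast
  moreover have "natural u 0 = u 0" "natural u 1 = u 1"
    using natural_norm_clock[OF topspace_PD(1)[OF u], of 0] natural_norm_clock[OF topspace_PD(1)[OF u], of 1]
      reparams0D(4,5)[OF norm_clock_reparams0[OF topspace_PD(1)[OF u]]] by auto
  ultimately show ?thesis
    using u by (simp add: topspace_P)
qed

lemma compose_reparams0_in_P:
  assumes "u \<in> topspace P" "\<phi> \<in> reparams0"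
  shows "compose unit_interval u \<phi> \<in> topspace P"
  using dpaths_reparam[OF topspace_PD(1)[OF assms(1)] reparams0D(6)[OF assms(2)]]
    reparams0D(4,5)[OF assms(2)] topspace_PD[OF assms(1)] by (simp add: topspace_P)

section \<open>Trace equivalence through constant-speed representatives\<close>

lemma natural_reparam:
  assumes u: "u \<in> topspace P" and \<phi>: "\<phi> \<in> reparams0"
  shows "natural (compose unit_interval u \<phi>) = natural u"
proof -
  let ?v = "compose unit_interval u \<phi>"
  note uD = topspace_PD(1)[OF u] and v = compose_reparams0_in_P[OF u \<phi>]
  note vD = topspace_PD(1)[OF v]
  have clock_v: "clock ?v t = clock u (\<phi> t)" if t: "t \<in> unit_interval" for t
  proof -
    obtain l where l: "continuous_on unit_interval l" "\<And>t. t \<in> unit_interval \<Longrightarrow> E (u t) = cis (l t)"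
      using E_lift[OF uD] by blast
    have "clock ?v t = (l \<circ> \<phi>) t - (l \<circ> \<phi>) 0"
    proof (rule clock(5)[OF vD, where l = "l \<circ> \<phi>" and t = t])
      show "continuous_on unit_interval (l \<circ> \<phi>)"
        using l(1) reparams0D[OF \<phi>] by (intro continuous_on_compose) (auto intro: continuous_on_subset)
      show "E (?v r) = cis ((l \<circ> \<phi>) r)" if "r \<in> unit_interval" for r
        using l(2)[OF reparams0D(2)[OF \<phi> that]] that by simp
    qed (rule t)
    moreover have "clock u (\<phi> t) = l (\<phi> t) - l 0"
      using l reparams0D(2)[OF \<phi> t] by (rule clock(5)[OF uD, where l = l and t = "\<phi> t"])
    ultimately show ?thesis
      using reparams0D(4)[OF \<phi>] by simp
  qed
  show ?thesis
  proof (cases "clock u 1 = 0")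
    \<comment> \<open>A vanishing clock is normalized to the identity, so normalization need not
      commute with \<phi> here; but the path is constant, and reparametrization leaves it
      unchanged.\<close>
    case True
    have const: "u t = u 0" if "t \<in> unit_interval" for t
      using constant_on_clock_interval[OF uD, of 0 t] that True clock(3)[OF uD]
        mono_onD[OF clock(2)[OF uD], of 0 t] mono_onD[OF clock(2)[OF uD], of t 1] by auto
    have "?v t = u t" if "t \<in> unit_interval" for t
      unfolding compose_eq_on[OF that] const[OF that] const[OF reparams0D(2)[OF \<phi> that]] ..
    then have "?v = u"
      by (rule extensionalityI[OF compose_extensional topspace_PD(4)[OF u]])
    then show ?thesis by simp
  next
    case False
    then have nc: "norm_clock ?v t = norm_clock u (\<phi> t)" if "t \<in> unit_interval" for t
      using clock_v[OF that] clock_v[of 1] reparams0D(5)[OF \<phi>] by (simp add: norm_clock_def)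
    show ?thesis
    proof (rule extensionalityI[where A = unit_interval])
      fix y assume y: "y \<in> unit_interval"
      obtain t where t: "t \<in> unit_interval" "norm_clock ?v t = y"
        using reparams0_surj[OF norm_clock_reparams0[OF vD] y] .
      \<comment> \<open>Both representatives take the value of \<open>u\<close> at
        \<open>\<phi> t\<close>, because \<open>y\<close> is the normalized clock of
        \<open>u\<close> there.\<close>
      have "natural ?v y = u (\<phi> t)"
        using natural_norm_clock[OF vD t(1)] t by simp
      moreover have "natural u y = u (\<phi> t)"
        using natural_norm_clock[OF uD reparams0D(2)[OF \<phi> t(1)]] nc[OF t(1)] t(2) by simp
      ultimately show "natural ?v y = natural u y" by simp
    qed (simp_all add: natural_def)
  qed
qed

text \<open>\<open>u\<close> is itself a reparametrization of \<open>natural u\<close>, so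
  \<open>natural_reparam\<close> applies to the latter.\<close>

lemma natural_natural:
  assumes u: "u \<in> topspace P"
  shows "natural (natural u) = natural u"
  using natural_reparam[OF natural_in_P[OF u] norm_clock_reparams0[OF topspace_PD(1)[OF u]]]
  by (simp add: compose_natural_norm_clock[OF u])

text \<open>\<open>natural\<close> is invariant under each generating step. Conversely, every
  \<open>w\<close> in \<open>P\<close> is one generating step away from \<open>natural w\<close>, so
  a zigzag of two steps joins paths with a common representative.\<close>

lemma trace_rel_eq: "trace_rel X \<alpha> \<beta> = {(u, v). u \<in> topspace P \<and> v \<in> topspace P \<and> natural u = natural v}"
proof -
  let ?r = "\<lambda>a b. a \<in> topspace P \<and> (\<exists>\<phi>\<in>reparams0. b = compose unit_interval a \<phi>)"
  have "natural u = natural v" if "equivclp ?r u v" for u v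
    using that
  proof (induction rule: equivclp_induct)
    case (step v w)
    then have "natural v = natural w"
      using natural_reparam by fastforce
    with step show ?case by simp
  qed simp
  moreover have "equivclp ?r u v" if u: "u \<in> topspace P" and v: "v \<in> topspace P" and eq: "natural u = natural v" for u v
  proof -
    have r: "?r (natural w) w" if "w \<in> topspace P" for w
      using natural_in_P[OF that] compose_natural_norm_clock[OF that]
        norm_clock_reparams0[OF topspace_PD(1)[OF that]] by metis
    have "equivclp ?r u (natural u)" "equivclp ?r (natural v) v"
      using r[OF u] r[OF v] by (auto intro: converse_r_into_equivclp r_into_equivclp)
    then show ?thesis
      unfolding eq by (rule equivclp_trans)
  qed
  ultimately show ?thesis
    unfolding trace_rel_def Let_def by blast
qed

lemma equiv_trace_rel: "equiv (topspace P) (trace_rel X \<alpha> \<beta>)"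
  unfolding trace_rel_eq by (auto intro!: equivI simp: refl_on_def sym_def trans_def)

section \<open>Straight-line deformation of the clocks\<close>

definition deform :: "(real \<Rightarrow> real) \<Rightarrow> real \<times> (real \<Rightarrow> 'a) \<Rightarrow> real \<Rightarrow> 'a" where
  "deform \<phi> = (\<lambda>(r, u). compose unit_interval (natural u) (\<lambda>t. (1 - r) * norm_clock u t + r * \<phi> t))"

lemma deform_in_P:
  assumes "\<phi> \<in> reparams0" "r \<in> unit_interval" "u \<in> topspace P"
  shows "deform \<phi> (r, u) \<in> topspace P"
  unfolding deform_def prod.case
  by (intro compose_reparams0_in_P natural_in_P reparams0_convex norm_clock_reparams0 topspace_PD(1) assms)

lemma continuous_map_deform:
  assumes \<phi>: "\<phi> \<in> reparams0"
  shows "continuous_map (prod_topology (top_of_set unit_interval) P) P (deform \<phi>)"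
proof (rule continuous_map_test_squares[OF delta_generated_dpath_space_between])
  let ?I2 = "unit_interval \<times> unit_interval"
  fix g assume g: "pathin P g"
  have gP: "g s \<in> topspace P" if "s \<in> unit_interval" for s
    using g that by (auto simp: pathin_def continuous_map_def)
  have "continuous_map (top_of_set ?I2) P (\<lambda>(r, s). deform \<phi> (r, g s))"
  proof (subst continuous_map_into_dpath_space_between[OF dpaths_path_maps])
    show "delta_generated (top_of_set ?I2)"
      by (simp add: convex_imp_delta_generated convex_Times)
    \<comment> \<open>Unfolding the path space turns the square in \<open>(r, s)\<close> into a cube
      with the time \<open>t\<close> in front. \<open>?\<kappa>\<close> records the deformed time
      and the parameter, so the family factors through the square of constant-speed
      representatives.\<close>
    let ?\<kappa> = "\<lambda>(t, r, s). ((1 - r) * norm_clock (g s) t + r * \<phi> t, s)"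
    have "continuous_on (unit_interval \<times> ?I2) (\<lambda>z. (\<lambda>(t, s). norm_clock (g s) t) (fst z, snd (snd z)))"
      by (rule continuous_on_compose2[OF continuous_on_norm_clock[OF g]]) (auto intro!: continuous_intros)
    moreover have "continuous_on (unit_interval \<times> ?I2) (\<lambda>z. \<phi> (fst z))"
      by (rule continuous_on_compose2[OF reparams0D(1)[OF \<phi>]]) (auto intro!: continuous_intros)
    ultimately have "continuous_on (unit_interval \<times> ?I2) ?\<kappa>"
      unfolding case_prod_unfold by (intro continuous_intros) auto
    moreover have "?\<kappa> ` (unit_interval \<times> ?I2) \<subseteq> ?I2"
      using reparams0D(2)[OF reparams0_convex[OF norm_clock_reparams0[OF topspace_PD(1)[OF gP]] \<phi>]] by auto
    ultimately have "continuous_map (top_of_set (unit_interval \<times> ?I2)) (top_of_set ?I2) ?\<kappa>"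
      by (simp only: continuous_map_subtopology_eu image_subset_iff_funcset simp_thms)
    from continuous_map_compose[OF this continuous_map_natural[OF g]]
    have "continuous_map (top_of_set (unit_interval \<times> ?I2)) (dtop X) (\<lambda>(t, r, s). deform \<phi> (r, g s) t)"
      by (rule continuous_map_eq) (auto simp: deform_def)
    then show "(\<lambda>(r, s). deform \<phi> (r, g s)) \<in> topspace (top_of_set ?I2) \<rightarrow> topspace P \<and>
        continuous_map (prod_topology (top_of_set unit_interval) (top_of_set ?I2)) (dtop X)
          (\<lambda>(t, a). (case a of (r, s) \<Rightarrow> deform \<phi> (r, g s)) t)"
      using deform_in_P[OF \<phi>] gP by (auto simp: square_topology case_prod_unfold)
  qed
  then show "continuous_map (prod_topology (top_of_set unit_interval) (top_of_set unit_interval)) P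
      (\<lambda>(r, s). deform \<phi> (r, g s))"
    by (simp add: square_topology)
qed

lemma deform_0: "u \<in> topspace P \<Longrightarrow> deform \<phi> (0, u) = u"
  using compose_natural_norm_clock by (simp add: deform_def)

lemma deform_1: "deform \<phi> (1, u) = compose unit_interval (natural u) \<phi>"
  by (simp add: deform_def)

lemma deform_norm_clock: "u \<in> topspace P \<Longrightarrow> deform (norm_clock u) (r, u) = u"
  using compose_natural_norm_clock[of u] by (simp add: deform_def algebra_simps)

section \<open>The trace map and its sections\<close>

abbreviation T where "T \<equiv> quotient_topology P (trace_rel X \<alpha> \<beta>)"
abbreviation q where "q u \<equiv> trace_rel X \<alpha> \<beta> `` {u}"

text \<open>Any representative of the class will do, since \<open>natural\<close> is constant on
  classes. The parameter \<phi> leaves room for a section through a prescribed path.\<close>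

definition section_at :: "(real \<Rightarrow> real) \<Rightarrow> (real \<Rightarrow> 'a) set \<Rightarrow> real \<Rightarrow> 'a" where
  "section_at \<phi> c = compose unit_interval (natural (SOME u. u \<in> c)) \<phi>"

lemma section_at_q:
  assumes "u \<in> topspace P"
  shows "section_at \<phi> (q u) = compose unit_interval (natural u) \<phi>"
proof -
  have "(SOME v. v \<in> q u) \<in> q u"
    using equiv_class_self[OF equiv_trace_rel assms] by (rule someI[where P = "\<lambda>v. v \<in> q u"])
  then have "natural (SOME v. v \<in> q u) = natural u"
    by (auto simp: trace_rel_eq)
  then show ?thesis
    by (simp add: section_at_def)
qed

text \<open>After composition with \<open>q\<close> this is the end \<open>r = 1\<close> of the
  deformation, and continuity descends to the quotient.\<close>

lemma continuous_map_section_at: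
  assumes "\<phi> \<in> reparams0"
  shows "continuous_map T P (section_at \<phi>)"
proof (rule continuous_map_from_quotient)
  have "continuous_map P (prod_topology (top_of_set unit_interval) P) (\<lambda>u. (1, u))"
    by (intro continuous_map_pairedI) auto
  from continuous_map_compose[OF this continuous_map_deform[OF assms]]
  show "continuous_map P P (\<lambda>u. section_at \<phi> (q u))"
    by (rule continuous_map_eq) (simp add: section_at_q deform_1)
qed

lemma q_section_at:
  assumes \<phi>: "\<phi> \<in> reparams0" and c: "c \<in> topspace T"
  shows "q (section_at \<phi> c) = c"
proof -
  obtain u where u: "u \<in> topspace P" "c = q u"
    using c by (auto elim!: quotientE)
  have "(section_at \<phi> c, u) \<in> trace_rel X \<alpha> \<beta>"
    using u section_at_q[OF u(1)] compose_reparams0_in_P[OF natural_in_P \<phi>]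
      natural_reparam[OF natural_in_P \<phi>] natural_natural by (simp add: trace_rel_eq)
  then show ?thesis
    using u equiv_class_eq[OF equiv_trace_rel] by metis
qed

text \<open>The property \<open>Q\<close> is carried along so that one homotopy serves both freely
  and relative to a base point. Since \<open>deform\<close> starts at the identity, the homotopy is
  reversed at the end.\<close>

lemma homotopic_section_at_q:
  assumes \<phi>: "\<phi> \<in> reparams0" and Q: "\<And>r. Q (\<lambda>u. deform \<phi> (r, u))"
    and cong: "\<And>h k. (\<And>u. u \<in> topspace P \<Longrightarrow> h u = k u) \<Longrightarrow> Q h \<longleftrightarrow> Q k"
  shows "homotopic_with Q P P (section_at \<phi> \<circ> q) id"
proof -
  have "homotopic_with Q P P id (section_at \<phi> \<circ> q)"
  proof (subst homotopic_with[OF cong])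
    show "\<exists>h. continuous_map (prod_topology (top_of_set unit_interval) P) P h \<and>
        (\<forall>u\<in>topspace P. h (0, u) = id u) \<and>
        (\<forall>u\<in>topspace P. h (1, u) = (section_at \<phi> \<circ> q) u) \<and>
        (\<forall>t\<in>unit_interval. Q (\<lambda>u. h (t, u)))"
      using continuous_map_deform[OF \<phi>] Q deform_0 deform_1 section_at_q by auto
  qed blast
  then show ?thesis
    by (rule homotopic_with_symD)
qed

lemma pointed_section:
  assumes x: "x \<in> topspace P"
  shows "\<exists>g. continuous_map T P g \<and> g (q x) = x \<and> (\<forall>c\<in>topspace T. q (g c) = c) \<and>
    homotopic_with (\<lambda>h. h x = x) P P (g \<circ> q) id"
proof -
  have nc: "norm_clock x \<in> reparams0"
    using norm_clock_reparams0 topspace_PD(1)[OF x] .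
  show ?thesis
    using continuous_map_section_at[OF nc] q_section_at[OF nc] section_at_q[OF x]
      compose_natural_norm_clock[OF x] homotopic_section_at_q[OF nc, of "\<lambda>h. h x = x"] deform_norm_clock[OF x] x
    by (intro exI[of _ "section_at (norm_clock x)"]) auto
qed

text \<open>The section is continuous and injective, so the image of a path \<open>g\<close> in
  \<open>T\<close> is the preimage under the section of the image of a path in \<open>P\<close>,
  which is closed.\<close>

lemma delta_Hausdorff_T:
  assumes "delta_Hausdorff (dtop X)"
  shows "delta_Hausdorff T"
  unfolding delta_Hausdorff_def
proof (intro allI impI)
  fix g assume g: "pathin T g"
  let ?\<sigma> = "section_at (\<lambda>t. t)"
  note \<sigma> = continuous_map_section_at[OF reparams0_id]
  have "pathin P (?\<sigma> \<circ> g)"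
    using g \<sigma> by (rule pathin_compose)
  then have "closedin P ((?\<sigma> \<circ> g) ` unit_interval)"
    using delta_Hausdorff_dpath_space_between[OF dpaths_path_maps assms] unfolding delta_Hausdorff_def by blast
  from closedin_continuous_map_preimage[OF \<sigma> this]
  have "closedin T {c \<in> topspace T. ?\<sigma> c \<in> (?\<sigma> \<circ> g) ` unit_interval}" .
  moreover have gT: "g s \<in> topspace T" if "s \<in> unit_interval" for s
    using g that by (auto simp: pathin_def continuous_map_def)
  have "{c \<in> topspace T. ?\<sigma> c \<in> (?\<sigma> \<circ> g) ` unit_interval} = g ` unit_interval"
  proof (intro equalityI subsetI)
    fix c assume "c \<in> {c \<in> topspace T. ?\<sigma> c \<in> (?\<sigma> \<circ> g) ` unit_interval}"
    then obtain s where c: "c \<in> topspace T" and s: "s \<in> unit_interval" and eq: "?\<sigma> c = ?\<sigma> (g s)"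
      by auto
    have "c = g s"
      using q_section_at[OF reparams0_id c] q_section_at[OF reparams0_id gT[OF s]] unfolding eq by simp
    with s show "c \<in> g ` unit_interval" by blast
  next
    fix c assume "c \<in> g ` unit_interval"
    then show "c \<in> {c \<in> topspace T. ?\<sigma> c \<in> (?\<sigma> \<circ> g) ` unit_interval}"
      using gT by (simp only: mem_Collect_eq image_comp[symmetric]) blast
  qed
  ultimately show "closedin T (g ` unit_interval)"
    by simp
qed

text \<open>In the Hausdorff case \<open>trace_rel\<close> is itself one of the relations being
  intersected, by \<open>delta_Hausdorff_T\<close>, and is contained in all of them.\<close>

lemma Top_trace_rel_eq:
  assumes "in_Top C (dtop X)"
  shows "Top_trace_rel C X \<alpha> \<beta> = trace_rel X \<alpha> \<beta>"
proof (cases C)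
  case Delta_Generated_Hausdorff
  then have "delta_Hausdorff T"
    using assms delta_Hausdorff_T by simp
  then show ?thesis
    using Delta_Generated_Hausdorff equiv_trace_rel by (auto simp: Top_trace_rel_def)
qed (simp add: Top_trace_rel_def)

lemma homotopy_equivalence_q: "homotopy_equivalence_map P T q"
  unfolding homotopy_equivalence_map_def
proof (intro conjI exI)
  show "continuous_map P T q"
    by (rule continuous_map_to_quotient)
  show "continuous_map T P (section_at (\<lambda>t. t))"
    by (intro continuous_map_section_at reparams0_id)
  show "homotopic_with (\<lambda>h. True) P P (section_at (\<lambda>t. t) \<circ> q) id"
    by (intro homotopic_section_at_q reparams0_id) auto
  \<comment> \<open>The section is strict, so a stationary homotopy suffices on this side.\<close>
  show "homotopic_with (\<lambda>h. True) T T (q \<circ> section_at (\<lambda>t. t)) id"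
    by (intro homotopic_with_equal continuous_map_compose[OF continuous_map_section_at continuous_map_to_quotient])
      (use q_section_at reparams0_id in auto)
qed

lemma weak_homotopy_equivalence_q: "weak_homotopy_equivalence_map P T q"
proof (rule pointed_homotopy_equivalences_imp_weak)
  show "continuous_map P T q"
    by (rule continuous_map_to_quotient)
  show "q ` topspace P = topspace T"
    by (auto simp: quotient_def)
qed (rule pointed_section)

end

section \<open>The clock of a regular clock map\<close>

text \<open>The usual exponential embedding of R/Z in the complex plane; periodicity makes the
  chosen representative irrelevant on classes.\<close>

definition circle_exp :: "real set \<Rightarrow> complex" where
  "circle_exp c = cis (2 * pi * (SOME x. x \<in> c))"

lemma circle_exp_class [simp]: "circle_exp (int_congruence `` {x}) = cis (2 * pi * x)"
proof -
  have "x \<in> int_congruence `` {x}"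
    by (simp add: int_congruence_def)
  then have "(SOME y. y \<in> int_congruence `` {x}) \<in> int_congruence `` {x}"
    by (rule someI[where P = "\<lambda>y. y \<in> int_congruence `` {x}"])
  then have "x - (SOME y. y \<in> int_congruence `` {x}) \<in> \<int>"
    by (simp add: int_congruence_def)
  then obtain n where "x - (SOME y. y \<in> int_congruence `` {x}) = of_int n"
    by (auto elim: Ints_cases)
  then have "x = (SOME y. y \<in> int_congruence `` {x}) + of_int n"
    by linarith
  then have "2 * pi * x = 2 * pi * (SOME y. y \<in> int_congruence `` {x}) + 2 * pi * of_int n"
    by (metis distrib_left)
  then show ?thesis
    unfolding circle_exp_def by (simp add: cis_multiple_2pi flip: cis_mult)
qed

lemma dtop_dcircle: "dtop dcircle = quotient_topology euclideanreal int_congruence"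
  by (simp add: dcircle_def Let_def)

lemma continuous_map_circle_exp: "continuous_map (dtop dcircle) euclidean circle_exp"
  unfolding dtop_dcircle
  by (rule continuous_map_from_quotient) (auto intro!: continuous_intros)

text \<open>Injectivity turns constancy of the exponential of \<open>p\<close> along a path into
  constancy of \<open>p\<close>, so that regularity of the clock map can be used.\<close>

lemma inj_on_circle_exp: "inj_on circle_exp (states dcircle)"
proof (rule inj_onI)
  fix c d assume "c \<in> states dcircle" "d \<in> states dcircle" and eq: "circle_exp c = circle_exp d"
  then obtain x y where xy: "c = int_congruence `` {x}" "d = int_congruence `` {y}"
    by (auto simp: dtop_dcircle elim!: quotientE)
  with eq obtain n :: int where "2 * pi * x - 2 * pi * y = 2 * pi * n"
    by (auto elim: cis_eq_imp_int_multiple)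
  then have "2 * pi * (x - y) = 2 * pi * n"
    by (simp add: algebra_simps)
  then have "x = y + of_int n"
    by simp
  then have "x - z = of_int n + (y - z)" for z
    by simp
  then have "x - z \<in> \<int> \<longleftrightarrow> y - z \<in> \<int>" for z
    by (metis Ints_add Ints_diff Ints_of_int add_diff_cancel_left')
  then show "c = d"
    by (simp add: xy int_congruence_def)
qed

lemma regular_clock_map_imp_clocked_dspace:
  assumes "regular_clock_map C X p"
  shows "clocked_dspace X (circle_exp \<circ> p)"
proof
  have dX: "directed_space C X" and p: "continuous_map (dtop X) (dtop dcircle) p"
    and pd: "\<And>u. u \<in> dpaths X \<Longrightarrow> compose unit_interval p u \<in> dpaths dcircle"
    and reg: "\<And>u. \<lbrakk>u \<in> dpaths X; (p \<circ> u) constant_on unit_interval\<rbrakk> \<Longrightarrow> u constant_on unit_interval"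
    using assms by (auto simp: regular_clock_map_def dmorphism_def)
  show "saturated X"
    using assms by (simp add: regular_clock_map_def)
  show paths: "dpaths X \<subseteq> path_maps (dtop X)"
    using dX by (simp add: directed_space_def)
  show "compose unit_interval u \<phi> \<in> dpaths X" if "u \<in> dpaths X" "\<phi> \<in> reparams" for u \<phi>
    using dX that by (simp add: directed_space_def)
  show "continuous_map (dtop X) euclidean (circle_exp \<circ> p)"
    using p continuous_map_circle_exp by (rule continuous_map_compose)
  fix u assume u: "u \<in> dpaths X"
  obtain l where l: "continuous_on unit_interval l" "mono_on unit_interval l"
    "\<And>t. t \<in> unit_interval \<Longrightarrow> compose unit_interval p u t = int_congruence `` {l t}"
    using pd[OF u] by (auto simp: dcircle_def Let_def)
  show "\<exists>l. continuous_on unit_interval l \<and> mono_on unit_interval l \<and>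
      (\<forall>t\<in>unit_interval. (circle_exp \<circ> p) (u t) = cis (l t))"
  proof (intro exI conjI ballI)
    show "continuous_on unit_interval (\<lambda>t. 2 * pi * l t)"
      by (intro continuous_intros l)
    show "mono_on unit_interval (\<lambda>t. 2 * pi * l t)"
      using l(2) by (simp add: mono_on_def)
    show "(circle_exp \<circ> p) (u t) = cis (2 * pi * l t)" if "t \<in> unit_interval" for t
      using l(3)[OF that] that by simp
  qed
  have "p (u t) \<in> states dcircle" if "t \<in> unit_interval" for t
  proof -
    have "pathin (dtop X) u"
      using u paths by (auto simp: path_maps_def)
    then show ?thesis
      using p that unfolding pathin_def continuous_map_def by fastforce
  qed
  then have "(p \<circ> u) constant_on unit_interval" if "((circle_exp \<circ> p) \<circ> u) constant_on unit_interval"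
    using that inj_onD[OF inj_on_circle_exp] unfolding constant_on_def comp_apply by metis
  then show "u constant_on unit_interval" if "((circle_exp \<circ> p) \<circ> u) constant_on unit_interval"
    using reg[OF u] that by blast
qed

theorem theorem6p7:
  fixes C :: top_choice
    and X :: "'a dspace"
    and p :: "'a \<Rightarrow> real set"
    and \<alpha> \<beta> :: 'a
  assumes "directed_space C X"
    and "saturated X"
    and "regular_clock_map C X p"
    and "\<alpha> \<in> states X"
    and "\<beta> \<in> states X"
  shows "homotopy_equivalence_map (dpath_space_between X \<alpha> \<beta>) (trace_space C X \<alpha> \<beta>)
           (trace_map C X \<alpha> \<beta>)
       \<and> weak_homotopy_equivalence_map (dpath_space_between X \<alpha> \<beta>) (trace_space C X \<alpha> \<beta>)
           (trace_map C X \<alpha> \<beta>)"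
proof -
  interpret clocked_dspace X "circle_exp \<circ> p" \<alpha> \<beta>
    using assms(3) by (rule regular_clock_map_imp_clocked_dspace)
  have rel: "Top_trace_rel C X \<alpha> \<beta> = trace_rel X \<alpha> \<beta>"
    using assms(1) by (intro Top_trace_rel_eq) (simp add: directed_space_def)
  then have "trace_map C X \<alpha> \<beta> = q"
    by (simp add: fun_eq_iff trace_map_def)
  then show ?thesis
    using homotopy_equivalence_q weak_homotopy_equivalence_q by (simp add: trace_space_def rel)
qed

end
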